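(* Let $d\geq 1$ and let $\mu$ be a finite Borel measure on $\mathbb{R}^d$ with support contained in $[\delta,1-\delta]^d$ for some $0<\delta<1/2$. Then for all $\theta\in(0,1]$ and $s>0$, $$\mathcal{J}_{s,\theta}(\mu)\approx_{\delta}\bigg( \big| \widehat{\mu}(0) \big|^{\frac{2}{\theta}} + \sum_{z\in\mathbb{Z}^d\setminus\{ 0 \}}\big| \widehat{\mu}(z) \big|^{\frac{2}{\theta}}|z|^{\frac{s}{\theta}-d} \bigg)^\theta .$$ In particular, for all $\theta\in(0,1]$, $$\dim^\theta_{\mathrm{F}} \mu = \sup\bigg\{ s\in\mathbb{R} :\sum_{z\in\mathbb{Z}^d\setminus\{ 0 \}}\big| \widehat{\mu}(z) \big|^{\frac{2}{\theta}}|z|^{\frac{s}{\theta}-d} <\infty \bigg\}.$$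
   Context: Measures are non-negative. The Fourier transform of a finite Borel measure $\mu$ on $\mathbb{R}^d$ is $\widehat{\mu}(z)=\int e^{-2\pi i z\cdot x}\,d\mu(x)$, $z\in\mathbb{R}^d$. For $\theta\in(0,1]$ and $s\geq 0$, the $(s,\theta)$-energy is $$\mathcal{J}_{s,\theta}(\mu)=\bigg(\int_{\mathbb{R}^d}|\widehat{\mu}(z)|^{\frac{2}{\theta}}|z|^{\frac{s}{\theta}-d}\,dz\bigg)^{\theta}\in[0,\infty].$$ The Fourier spectrum of $\mu$ at $\theta$ is $\dim^\theta_{\mathrm{F}}\mu=\sup\{s\geq 0:\mathcal{J}_{s,\theta}(\mu)<\infty\}\in[0,\infty]$, with the supremum of the empty set taken to be $0$. Notation: $A\lesssim B$ means $A\leq cB$ for some constant $c>0$, and $A\approx B$ means $A\lesssim B$ and $B\lesssim A$; a subscript emphasises a parameter on which the constant depends. By convention $A\lesssim\infty$ for all $A>0$ and $\infty\approx\infty$ (so both sides are finite or both are infinite). Here the constants may depend on $\delta$ and on $d,s,\theta$, but not on $\mu$. *)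

theory Defs
  imports "HOL-Analysis.Analysis"
begin

definition measure_support :: "'a::topological_space measure \<Rightarrow> 'a set" where
  "measure_support \<mu> = {x. \<forall>U. open U \<longrightarrow> x \<in> U \<longrightarrow> emeasure \<mu> U > 0}"

definition fourier_transform :: "(real ^ 'n) measure \<Rightarrow> real ^ 'n \<Rightarrow> complex" where
  "fourier_transform \<mu> z =
     (LINT x|\<mu>. exp (- 2 * complex_of_real pi * \<i> * complex_of_real (z \<bullet> x)))"

text \<open>Powers with exponent \<open>a > 0\<close> of a quantity in \<open>[0, \<infinity>]\<close>, with \<open>\<infinity>\<^sup>a = \<infinity>\<close>.\<close>

definition ennreal_powr :: "ennreal \<Rightarrow> real \<Rightarrow> ennreal" where
  "ennreal_powr x a = (if x = \<infinity> then \<infinity> else ennreal (enn2real x powr a))"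

text \<open>Since \<open>0 powr a = 0\<close>, the integrand vanishes at the origin whatever the sign of the
  exponent; this is a null set.\<close>

definition energy :: "real \<Rightarrow> real \<Rightarrow> (real ^ 'n) measure \<Rightarrow> ennreal" where
  "energy s \<theta> \<mu> = ennreal_powr
     (\<integral>\<^sup>+ z. ennreal (norm (fourier_transform \<mu> z) powr (2 / \<theta>) *
                    norm z powr (s / \<theta> - real CARD('n))) \<partial>lborel) \<theta>"

text \<open>The supremum of the empty set in \<^typ>\<open>ennreal\<close> is \<open>0\<close>.\<close>

definition fourier_spectrum :: "real \<Rightarrow> (real ^ 'n) measure \<Rightarrow> ennreal" where
  "fourier_spectrum \<theta> \<mu> = Sup {ennreal s | s. s \<ge> 0 \<and> energy s \<theta> \<mu> < \<infinity>}"

definition int_lattice :: "(real ^ 'n) set" where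
  "int_lattice = {z. \<forall>i. z $ i \<in> \<int>}"

text \<open>A sum of non-negative terms in \<^typ>\<open>ennreal\<close>, hence always defined.\<close>

definition lattice_sum :: "real \<Rightarrow> real \<Rightarrow> (real ^ 'n) measure \<Rightarrow> ennreal" where
  "lattice_sum s \<theta> \<mu> =
     (\<Sum>\<^sub>\<infinity> z \<in> int_lattice - {0}. ennreal (norm (fourier_transform \<mu> z) powr (2 / \<theta>) *
                                     norm z powr (s / \<theta> - real CARD('n))))"

end

theory Submission
  imports Defs "HOL-Complex_Analysis.Cauchy_Integral_Formula"
begin

text \<open>
  Write \<open>f\<close> for the Fourier transform of \<open>\<mu>\<close>, \<open>p = 2 / \<theta>\<close>, \<open>\<alpha> = s / \<theta> - d\<close> and \<open>bracket z = 1 + norm z\<close>.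
  Because \<open>\<mu>\<close> lives on a cube strictly inside a fundamental domain of the integer lattice, \<open>f\<close> is
  determined by its values on any translate of that lattice, through a sampling formula
  \<open>f (z + t) = (\<Sum>j. K (z - j) * f (j + t))\<close> whose kernel \<open>K\<close> decays faster than any prescribed power.
  The room left between the cube and the boundary of the fundamental domain is what buys the decay:
  the classical sampling series with the cardinal sine is averaged repeatedly over short intervals
  (\<open>box_series_uniform_limit\<close>, \<open>box_average_uniform_limit\<close>, \<open>sampling_kernel\<close>).

  Jensen's inequality and Peetre's inequality for the weight \<open>bracket z powr \<alpha>\<close> turn the sampling
  formula into an estimate between sums over shifted lattices: the quantities
  \<open>\<Phi> t = (\<Sum>j. bracket j powr \<alpha> * norm (f (j + t)) powr p)\<close>, for \<open>t\<close> in the unit cube, are all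
  comparable, with constants independent of \<open>\<mu>\<close> (\<open>lattice_block_comparable\<close>). The integral of
  \<open>bracket z powr \<alpha> * norm (f z) powr p\<close> is essentially the average of \<open>\<Phi>\<close> over the unit cube, hence
  comparable to \<open>\<Phi> 0\<close>. Both inequalities between sum and integral follow from this single
  comparison, without Fourier inversion on the space.

  It remains to pass between the inhomogeneous weight and \<open>norm z powr \<alpha>\<close>. On nonzero lattice points
  and away from the origin they are comparable. Near the origin \<open>norm (f z)\<close> is at most
  \<open>norm (f 0)\<close>, and at least half of it on a ball of fixed radius, while \<open>norm z powr \<alpha>\<close> is integrable
  because \<open>s > 0\<close> (\<open>riesz_energy_le\<close>, \<open>bracket_energy_le\<close>).

  For the spectrum, the comparison shows that energy and lattice sum are finite for the same
  \<open>s > 0\<close>, and the lattice sum is finite for every \<open>s < 0\<close> since \<open>f\<close> is bounded, so that the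
  supremum over all real \<open>s\<close> is nonnegative.
\<close>

section \<open>Japanese brackets\<close>

text \<open>
  The usual inhomogeneous weight \<open>\<langle>x\<rangle>\<close>. In the form \<open>1 + norm x\<close> it is exactly
  submultiplicative, so that Peetre's inequality carries no constant.
\<close>

definition bracket :: "'a::real_normed_vector \<Rightarrow> real" where
  "bracket x = 1 + norm x"

lemma bracket_ge_1: "1 \<le> bracket x" by (simp add: bracket_def)

lemma bracket_pos [simp]: "0 < bracket x" by (simp add: bracket_def add_pos_nonneg)

lemma bracket_nonneg [simp]: "0 \<le> bracket x" by (simp add: bracket_def)

lemma bracket_powr_le_1: "q \<le> 0 \<Longrightarrow> bracket x powr q \<le> 1"
  using powr_mono[OF _ bracket_ge_1, of q 0 x] by (simp add: less_imp_neq[OF bracket_pos, symmetric])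

lemma bracket_submultiplicative: "bracket (x + y) \<le> bracket x * bracket y"
proof -
  have "bracket (x + y) \<le> 1 + (norm x + norm y)" by (simp add: bracket_def norm_triangle_ineq)
  also have "\<dots> \<le> bracket x * bracket y" by (simp add: bracket_def algebra_simps)
  finally show ?thesis .
qed

text \<open>
  For \<open>\<alpha> \<ge> 0\<close> this is submultiplicativity; for \<open>\<alpha> < 0\<close> it is submultiplicativity applied to
  \<open>x = (x + y) + (- y)\<close>. It is what allows a weight to be moved from one lattice point to
  another at the price of a power of their distance.
\<close>

lemma peetre_inequality:
  "bracket (x + y) powr \<alpha> \<le> bracket x powr \<alpha> * bracket y powr \<bar>\<alpha>\<bar>"
proof (cases "0 \<le> \<alpha>")
  case True
  have "bracket (x + y) powr \<alpha> \<le> (bracket x * bracket y) powr \<alpha>"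
    by (intro powr_mono2 True bracket_submultiplicative bracket_nonneg)
  with True show ?thesis by (simp add: powr_mult)
next
  case False
  have "bracket x \<le> bracket (x + y) * bracket y"
    using bracket_submultiplicative[of "x + y" "- y"] by (simp add: bracket_def)
  then have "(bracket (x + y) * bracket y) powr \<alpha> \<le> bracket x powr \<alpha>"
    using False by (intro powr_mono2') auto
  then have "bracket (x + y) powr \<alpha> * bracket y powr \<alpha> * bracket y powr (- \<alpha>) \<le> bracket x powr \<alpha> * bracket y powr (- \<alpha>)"
    by (intro mult_right_mono) (auto simp: powr_mult)
  moreover have "bracket y powr \<alpha> * bracket y powr (- \<alpha>) = 1"
    by (simp flip: powr_add add: less_imp_neq[OF bracket_pos, symmetric])
  ultimately show ?thesis using False by (simp add: mult.assoc)
qed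

text \<open>
  Away from the origin the homogeneous weight \<open>norm z powr \<alpha>\<close> and the inhomogeneous one agree up
  to a constant, because \<open>norm z \<le> bracket z \<le> (1 + 1 / r) * norm z\<close>.
\<close>

lemma bracket_norm_powr_comparable:
  assumes r: "0 < r" and z: "r \<le> norm z"
  shows "norm z powr \<alpha> \<le> (1 + 1 / r) powr \<bar>\<alpha>\<bar> * bracket z powr \<alpha>"
    and "bracket z powr \<alpha> \<le> (1 + 1 / r) powr \<bar>\<alpha>\<bar> * norm z powr \<alpha>"
proof -
  have nz: "0 < norm z" using r z by linarith
  have le1: "norm z \<le> bracket z" by (simp add: bracket_def)
  have le2: "bracket z \<le> (1 + 1 / r) * norm z"
    using r z by (simp add: bracket_def field_simps)
  have c: "1 \<le> (1 + 1 / r) powr \<bar>\<alpha>\<bar>" using r by (intro ge_one_powr_ge_zero) auto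
  have trivial: "x \<le> (1 + 1 / r) powr \<bar>\<alpha>\<bar> * y" if "x \<le> y" "0 \<le> y" for x y :: real
    using mult_right_mono[OF c that(2)] that(1) by simp
  have "norm z powr \<alpha> \<le> (1 + 1 / r) powr \<bar>\<alpha>\<bar> * bracket z powr \<alpha> \<and>
     bracket z powr \<alpha> \<le> (1 + 1 / r) powr \<bar>\<alpha>\<bar> * norm z powr \<alpha>"
  proof (cases "0 \<le> \<alpha>")
    case True
    have 1: "norm z powr \<alpha> \<le> bracket z powr \<alpha>" using True le1 by (intro powr_mono2) auto
    have 2: "bracket z powr \<alpha> \<le> ((1 + 1 / r) * norm z) powr \<alpha>"
      using True le2 by (intro powr_mono2) auto
    show ?thesis using trivial[OF 1] 2 True r by (simp add: powr_mult)
  next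
    case False
    have 1: "bracket z powr \<alpha> \<le> norm z powr \<alpha>" using False le1 nz by (intro powr_mono2') auto
    have "((1 + 1 / r) * norm z) powr \<alpha> \<le> bracket z powr \<alpha>"
      using False le2 by (intro powr_mono2') auto
    then have "(1 + 1 / r) powr (- \<alpha>) * ((1 + 1 / r) powr \<alpha> * norm z powr \<alpha>) \<le> (1 + 1 / r) powr (- \<alpha>) * bracket z powr \<alpha>"
      using r by (intro mult_left_mono) (auto simp: powr_mult)
    then have 2: "norm z powr \<alpha> \<le> (1 + 1 / r) powr (- \<alpha>) * bracket z powr \<alpha>"
      using r by (simp add: mult.assoc[symmetric] add_pos_pos less_imp_neq[symmetric] flip: powr_add)
    show ?thesis using trivial[OF 1] 2 False by simp
  qed
  then show "norm z powr \<alpha> \<le> (1 + 1 / r) powr \<bar>\<alpha>\<bar> * bracket z powr \<alpha>"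
    and "bracket z powr \<alpha> \<le> (1 + 1 / r) powr \<bar>\<alpha>\<bar> * norm z powr \<alpha>" by auto
qed

section \<open>Characters and box kernels\<close>

definition e_char :: "real \<Rightarrow> complex" where
  "e_char t = cis (2 * pi * t)"

lemma norm_e_char [simp]: "norm (e_char t) = 1"
  by (simp add: e_char_def)

lemma e_char_0 [simp]: "e_char 0 = 1"
  by (simp add: e_char_def)

lemma e_char_add: "e_char (s + t) = e_char s * e_char t"
  by (simp add: e_char_def cis_mult distrib_left)

lemma e_char_int: "e_char (of_int j) = 1"
  unfolding e_char_def by (rule cis_multiple_2pi) auto

lemma continuous_on_e_char [continuous_intros]:
  "continuous_on A f \<Longrightarrow> continuous_on A (\<lambda>x. e_char (f x))"
  unfolding e_char_def by (intro continuous_intros)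

lemma e_char_has_vector_derivative:
  "((\<lambda>y. e_char (v * y)) has_vector_derivative (2 * pi * v) *\<^sub>R (\<i> * e_char (v * y))) (at y within A)"
proof -
  have "((\<lambda>y. exp (\<i> * of_real (2 * pi * v) * of_real y)) has_vector_derivative
      exp (\<i> * of_real (2 * pi * v) * of_real y) * (\<i> * of_real (2 * pi * v))) (at y)"
    by (rule has_vector_derivative_real_field) (auto intro!: derivative_eq_intros)
  then have "((\<lambda>y. e_char (v * y)) has_vector_derivative (2 * pi * v) *\<^sub>R (\<i> * e_char (v * y))) (at y)"
    by (simp add: e_char_def cis_conv_exp scaleR_conv_of_real mult_ac)
  then show ?thesis by (rule has_vector_derivative_at_within)
qed

text \<open>
  The Fourier transform of the uniform probability density on \<open>[-a/2, a/2]\<close>. For \<open>a = 1\<close> it is the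
  cardinal sine, the kernel of the Shannon sampling series.
\<close>

definition box_kernel :: "real \<Rightarrow> real \<Rightarrow> complex" where
  "box_kernel a v = integral {-(a/2)..a/2} (\<lambda>y. e_char (v * y)) / complex_of_real a"

lemma norm_box_kernel_le_1:
  assumes "0 < a" shows "norm (box_kernel a v) \<le> 1"
proof -
  have "norm (integral {-(a/2)..a/2} (\<lambda>y. e_char (v * y))) \<le> 1 * (a/2 - (-(a/2)))"
    by (rule integral_bound) (use assms in \<open>auto intro!: continuous_intros\<close>)
  with assms show ?thesis by (simp add: box_kernel_def norm_divide)
qed

lemma box_kernel_formula:
  assumes "0 < a" "v \<noteq> 0"
  shows "box_kernel a v = (e_char (v * (a/2)) - e_char (- (v * (a/2)))) / (2 * pi * \<i> * v * a)"
proof -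
  have "((\<lambda>y. e_char (v * y)) has_integral
      (e_char (v * (a/2)) / (2 * pi * \<i> * v) - e_char (v * (-(a/2))) / (2 * pi * \<i> * v))) {-(a/2)..a/2}"
  proof (rule fundamental_theorem_of_calculus)
    show "((\<lambda>y. e_char (v * y) / (2 * pi * \<i> * v)) has_vector_derivative e_char (v * x)) (at x within {-(a/2)..a/2})" for x
      by (rule derivative_eq_intros e_char_has_vector_derivative refl | simp)+
         (use assms in \<open>simp add: scaleR_conv_of_real field_simps\<close>)
  qed (use assms in auto)
  then show ?thesis
    unfolding box_kernel_def by (subst integral_unique) (use assms in \<open>auto simp: field_simps\<close>)
qed

lemma norm_box_kernel_decay:
  assumes "0 < a"
  shows "norm (box_kernel a v) \<le> (1 + 1 / (pi * a)) / (1 + \<bar>v\<bar>)"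
proof (cases "v = 0")
  case True
  have "norm (box_kernel a v) \<le> 1" by (rule norm_box_kernel_le_1[OF assms])
  also have "1 \<le> 1 + 1 / (pi * a)" using assms by simp
  finally show ?thesis using True by simp
next
  case False
  have "norm (box_kernel a v) \<le> (1 + 1) / (2 * pi * \<bar>v\<bar> * a)"
    unfolding box_kernel_formula[OF assms False] norm_divide
  proof (rule frac_le)
    show "norm (e_char (v * (a/2)) - e_char (- (v * (a/2)))) \<le> 1 + 1"
      by (rule norm_triangle_le_diff) simp
  qed (use False assms in \<open>auto simp: norm_mult\<close>)
  then have "norm (box_kernel a v) * \<bar>v\<bar> \<le> 1 / (pi * a)"
    using False assms by (simp add: field_simps)
  moreover have "norm (box_kernel a v) \<le> 1" by (rule norm_box_kernel_le_1[OF assms])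
  ultimately have "norm (box_kernel a v) * (1 + \<bar>v\<bar>) \<le> 1 + 1 / (pi * a)"
    by (simp add: distrib_left)
  then show ?thesis by (simp add: field_simps)
qed

text \<open>
  The integers are zeros of the cardinal sine. In terms of Fourier series, the constant function
  \<open>1\<close> has a single nonzero coefficient.
\<close>

lemma box_kernel_int:
  "box_kernel 1 (of_int j) = (if j = 0 then 1 else 0)"
proof (cases "j = 0")
  case True then show ?thesis by (simp add: box_kernel_def)
next
  case False
  have "e_char (of_int j * (1/2)) = e_char (of_int j + (- (of_int j * (1/2))))" by simp
  also have "\<dots> = e_char (- (of_int j * (1/2)))"
    unfolding e_char_add by (simp add: e_char_int)
  finally show ?thesis using False box_kernel_formula[of 1 "of_int j"] by simp
qed

text \<open>
  The difference quotient that appears when the Dirichlet kernel is summed. On \<open>(-1, 1)\<close> the only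
  zero of the denominator \<open>e_char t - 1\<close> is \<open>t = 0\<close>, and there it cancels against the zero of the
  numerator; writing \<open>exp z - 1 = z * E z\<close> with \<open>E\<close> entire exhibits the quotient as a smooth
  function.
\<close>

lemma e_char_quotient_smooth:
  fixes u :: real
  obtains G G' :: "real \<Rightarrow> complex" where
    "continuous_on {-1<..<1} G'"
    "\<And>t. t \<in> {-1<..<1} \<Longrightarrow> (G has_vector_derivative G' t) (at t)"
    "\<And>t. t \<in> {-1<..<1} \<Longrightarrow> e_char (u * t) - 1 = G t * (e_char t - 1)"
proof -
  define E :: "complex \<Rightarrow> complex" where
    "E z = (if z = 0 then deriv exp 0 else (exp z - exp 0) / (z - 0))" for z
  have holE: "E holomorphic_on UNIV"
    unfolding E_def by (rule pole_lemma_open) (auto intro: holomorphic_intros)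
  have expE: "exp z - 1 = z * E z" for z by (auto simp: E_def)
  define H where "H z = of_real u * E (2 * pi * \<i> * u * z) / E (2 * pi * \<i> * z)" for z
  have E_nz: "E (2 * pi * \<i> * z) \<noteq> 0" if "z \<in> ball 0 1" for z
  proof (cases "z = 0")
    case True then show ?thesis by (simp add: E_def DERIV_imp_deriv[OF DERIV_exp])
  next
    case False
    show ?thesis
    proof
      assume "E (2 * pi * \<i> * z) = 0"
      then have "exp (2 * pi * \<i> * z) = 1" using expE[of "2 * pi * \<i> * z"] by simp
      then obtain n :: int where n: "Re (2 * pi * \<i> * z) = 0" "Im (2 * pi * \<i> * z) = of_int (2 * n) * pi"
        unfolding exp_eq_1 by auto
      from n have "Im z = 0" "Re z = of_int n" by auto
      then have "z = of_int n" by (simp add: complex_eq_iff)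
      then show False using that False by auto
    qed
  qed
  have holH: "H holomorphic_on ball 0 1"
    unfolding H_def
    by (intro holomorphic_intros holomorphic_on_compose_gen[OF _ holE, unfolded o_def])
       (use E_nz in auto)
  have sub: "complex_of_real t \<in> ball 0 1" if "t \<in> {-1<..<1}" for t using that by auto
  show thesis
  proof
    have "continuous_on (ball 0 1) (deriv H)"
      by (intro holomorphic_on_imp_continuous_on holomorphic_deriv holH) auto
    then show "continuous_on {-1<..<1} (\<lambda>t. deriv H (complex_of_real t))"
      by (rule continuous_on_compose2) (use sub in \<open>auto intro!: continuous_intros\<close>)
    show "((\<lambda>t. H (complex_of_real t)) has_vector_derivative deriv H (complex_of_real t)) (at t)"
      if "t \<in> {-1<..<1}" for t
      by (rule has_vector_derivative_real_field, rule holomorphic_derivI[OF holH])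
         (use sub[OF that] in auto)
    show "e_char (u * t) - 1 = H (complex_of_real t) * (e_char t - 1)" if "t \<in> {-1<..<1}" for t
    proof -
      have "e_char (u * t) - 1 = 2 * pi * \<i> * u * t * E (2 * pi * \<i> * u * t)"
        using expE[of "2 * pi * \<i> * u * t"] by (simp add: e_char_def cis_conv_exp mult_ac)
      moreover have "e_char t - 1 = 2 * pi * \<i> * t * E (2 * pi * \<i> * t)"
        using expE[of "2 * pi * \<i> * t"] by (simp add: e_char_def cis_conv_exp mult_ac)
      ultimately show ?thesis using E_nz[OF sub[OF that]] by (simp add: H_def)
    qed
  qed
qed

text \<open>
  One integration by parts gains the factor \<open>1 / \<bar>w\<bar>\<close>. The constant depends only on bounds for
  \<open>G\<close> and \<open>G'\<close> on \<open>[-1/2 - r, 1/2 + r]\<close>, hence not on the translation parameter \<open>x\<close>; this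
  uniformity is what makes the sampling series converge uniformly.
\<close>

lemma oscillatory_integral_decay:
  fixes G G' :: "real \<Rightarrow> complex"
  assumes contG': "continuous_on {-1<..<1} G'"
    and deriv: "\<And>t. t \<in> {-1<..<1} \<Longrightarrow> (G has_vector_derivative G' t) (at t)"
    and r: "0 \<le> r" "r < 1/2"
  obtains C where "0 \<le> C"
    "\<And>x w. \<lbrakk>x \<in> {-r..r}; w \<noteq> 0\<rbrakk> \<Longrightarrow>
       norm (integral {-(1/2)..1/2} (\<lambda>y. G (y - x) * e_char (w * (y - x)))) \<le> C / \<bar>w\<bar>"
proof -
  let ?I = "{-(1/2+r)..1/2+r}"
  have sub: "?I \<subseteq> {-1<..<1}" using r by auto
  have contG: "continuous_on {-1<..<1} G"
    by (intro continuous_at_imp_continuous_on ballI has_vector_derivative_continuous[OF deriv])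
  have bdd: "bounded (F ` ?I)" if "continuous_on {-1<..<1} F" for F :: "real \<Rightarrow> complex"
    by (intro compact_imp_bounded compact_continuous_image continuous_on_subset[OF that sub]) auto
  obtain A B where AB: "\<And>t. t \<in> ?I \<Longrightarrow> norm (G t) \<le> A" "\<And>t. t \<in> ?I \<Longrightarrow> norm (G' t) \<le> B"
    using bdd[OF contG] bdd[OF contG'] unfolding bounded_iff by blast
  define C where "C = max A B"
  have C: "norm (G t) \<le> C" "norm (G' t) \<le> C" if "t \<in> ?I" for t
    using AB[OF that] by (auto simp: C_def)
  have C0: "0 \<le> C" using order_trans[OF norm_ge_zero C(1)[of 0]] r by auto
  show thesis
  proof
    show "0 \<le> C" by fact
    fix x w :: real assume x: "x \<in> {-r..r}" and w: "w \<noteq> 0"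
    have in_I: "y - x \<in> ?I" if "y \<in> {-(1/2)..1/2}" for y using that x by auto
    then have in_1: "y - x \<in> {-1<..<1}" if "y \<in> {-(1/2)..1/2}" for y using that sub by blast
    let ?c = "2 * complex_of_real pi * \<i> * complex_of_real w"
    define F where "F y = G (y - x) * e_char (w * (y - x)) / ?c" for y
    define g where "g y = G' (y - x) * e_char (w * (y - x)) / ?c" for y
    have F_bound: "norm (F y) \<le> C / (2 * pi * \<bar>w\<bar>)" "norm (g y) \<le> C / (2 * pi * \<bar>w\<bar>)"
      if "y \<in> {-(1/2)..1/2}" for y
      using C[OF in_I[OF that]] by (auto simp: F_def g_def norm_mult norm_divide intro!: divide_right_mono)
    have derivF: "(F has_vector_derivative G (y - x) * e_char (w * (y - x)) + g y) (at y within {-(1/2)..1/2})"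
      if y: "y \<in> {-(1/2)..1/2}" for y
    proof -
      have shift: "((\<lambda>y. y - x) has_vector_derivative 1) (at y)"
        by (subst has_real_derivative_iff_has_vector_derivative[symmetric]) (auto intro!: derivative_eq_intros)
      have 1: "((\<lambda>y. G (y - x)) has_vector_derivative G' (y - x)) (at y)"
        using vector_diff_chain_at[OF shift deriv[OF in_1[OF y]]] by (simp add: o_def)
      have 2: "((\<lambda>y. e_char (w * (y - x))) has_vector_derivative (2 * pi * w) *\<^sub>R (\<i> * e_char (w * (y - x)))) (at y)"
        using vector_diff_chain_at[OF shift e_char_has_vector_derivative] by (simp add: o_def)
      have "(F has_vector_derivative G (y - x) * e_char (w * (y - x)) + g y) (at y)"
        unfolding F_def g_def
        by (rule derivative_eq_intros 1 2 refl | simp)+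
           (use w in \<open>simp add: scaleR_conv_of_real field_simps\<close>)
      then show ?thesis by (rule has_vector_derivative_at_within)
    qed
    have ftc: "((\<lambda>y. G (y - x) * e_char (w * (y - x)) + g y) has_integral (F (1/2) - F (-(1/2)))) {-(1/2)..1/2}"
      by (rule fundamental_theorem_of_calculus) (use derivF in auto)
    have contg: "continuous_on {-(1/2)..1/2} g"
      unfolding g_def
      by (intro continuous_intros continuous_on_compose2[OF contG']) (use in_1 w x r in auto)
    have intg: "g integrable_on {-(1/2)..1/2}" by (rule integrable_continuous_interval[OF contg])
    have "((\<lambda>y. G (y - x) * e_char (w * (y - x))) has_integral
        (F (1/2) - F (-(1/2)) - integral {-(1/2)..1/2} g)) {-(1/2)..1/2}"
      using has_integral_diff[OF ftc integrable_integral[OF intg]] by simp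
    then have "norm (integral {-(1/2)..1/2} (\<lambda>y. G (y - x) * e_char (w * (y - x)))) =
        norm (F (1/2) - F (-(1/2)) - integral {-(1/2)..1/2} g)"
      by (simp add: integral_unique)
    also have "\<dots> \<le> norm (F (1/2)) + norm (F (-(1/2))) + norm (integral {-(1/2)..1/2} g)"
      using norm_triangle_ineq4[of "F (1/2) - F (-(1/2))" "integral {-(1/2)..1/2} g"]
        norm_triangle_ineq4[of "F (1/2)" "F (-(1/2))"] by linarith
    also have "\<dots> \<le> C / (2 * pi * \<bar>w\<bar>) + C / (2 * pi * \<bar>w\<bar>) + C / (2 * pi * \<bar>w\<bar>)"
      using integral_bound[of "-(1/2)" "1/2" g "C / (2 * pi * \<bar>w\<bar>)"] contg F_bound
      by (intro add_mono F_bound) auto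
    also have "\<dots> = (C / \<bar>w\<bar>) * (3 / (2 * pi))" using w by (simp add: field_simps)
    also have "\<dots> \<le> (C / \<bar>w\<bar>) * 1"
      using pi_gt3 C0 by (intro mult_left_mono) auto
    finally show "norm (integral {-(1/2)..1/2} (\<lambda>y. G (y - x) * e_char (w * (y - x)))) \<le> C / \<bar>w\<bar>" by simp
  qed
qed

section \<open>Sampling on the line\<close>

lemma dirichlet_kernel_telescope:
  "(\<Sum>j\<in>{-int m..int m}. e_char (- (of_int j * t))) * (e_char t - 1)
     = e_char (real (Suc m) * t) - e_char (- (real m * t))"
proof (induction m)
  case 0 then show ?case by simp
next
  case (Suc m)
  have *: "{-int (Suc m)..int (Suc m)} = insert (-int (Suc m)) (insert (int (Suc m)) {-int m..int m})"
    by auto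
  have "(\<Sum>j\<in>{-int (Suc m)..int (Suc m)}. e_char (- (of_int j * t))) =
     e_char (real (Suc m) * t) + e_char (- (real (Suc m) * t)) + (\<Sum>j\<in>{-int m..int m}. e_char (- (of_int j * t)))"
    unfolding * by (subst sum.insert, simp, simp, subst sum.insert) (auto simp: algebra_simps)
  moreover have "e_char (real (Suc m) * t) * e_char t = e_char (real (Suc (Suc m)) * t)"
    "e_char (- (real (Suc m) * t)) * e_char t = e_char (- (real m * t))"
    by (simp_all flip: e_char_add add: algebra_simps)
  ultimately show ?case using Suc.IH by (simp add: algebra_simps del: of_nat_Suc)
qed

text \<open>
  The coefficients \<open>box_kernel 1 (u - j)\<close> are the Fourier coefficients of \<open>y \<mapsto> e_char (u * y)\<close> on
  \<open>[-1/2, 1/2]\<close>, so the claim is convergence of a Fourier series on compact parts of the open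
  interval. The error is \<open>\<integral> (e_char (u * y) - e_char (u * x)) * D\<^sub>m (y - x) dy\<close> with \<open>D\<^sub>m\<close> the
  Dirichlet kernel. Dividing and multiplying by \<open>e_char (y - x) - 1\<close> turns the first factor into a
  smooth function and telescopes the second into two pure oscillations, which decay.
\<close>

lemma box_series_uniform_limit:
  fixes u r :: real
  assumes r: "0 \<le> r" "r < 1/2"
  shows "uniform_limit {-r..r}
     (\<lambda>m x. \<Sum>j\<in>{-int m..int m}. box_kernel 1 (u - of_int j) * e_char (of_int j * x))
     (\<lambda>x. e_char (u * x)) sequentially"
proof -
  obtain G G' :: "real \<Rightarrow> complex" where G: "continuous_on {-1<..<1} G'"
    "\<And>t. t \<in> {-1<..<1} \<Longrightarrow> (G has_vector_derivative G' t) (at t)"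
    "\<And>t. t \<in> {-1<..<1} \<Longrightarrow> e_char (u * t) - 1 = G t * (e_char t - 1)"
    by (rule e_char_quotient_smooth[of u]) (rule that)
  have contG: "continuous_on {-1<..<1} G"
    by (intro continuous_at_imp_continuous_on ballI has_vector_derivative_continuous[OF G(2)])
  obtain C where C: "0 \<le> C"
    "\<And>x w. \<lbrakk>x \<in> {-r..r}; w \<noteq> 0\<rbrakk> \<Longrightarrow>
       norm (integral {-(1/2)..1/2} (\<lambda>y. G (y - x) * e_char (w * (y - x)))) \<le> C / \<bar>w\<bar>"
    by (rule oscillatory_integral_decay[OF G(1,2) r]) (assumption, rule that)
  let ?I = "{-(1/2)..1/2::real}"
  define D where "D m t = (\<Sum>j\<in>{-int m..int m}. e_char (- (of_int j * t)))" for m t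
  define S where "S v m x = (\<Sum>j\<in>{-int m..int m}. box_kernel 1 (v - of_int j) * e_char (of_int j * x))"
    for v :: real and m x
  have S_int: "((\<lambda>y. e_char (v * y) * D m (y - x)) has_integral S v m x) ?I" for v m x
  proof -
    have "((\<lambda>y. \<Sum>j\<in>{-int m..int m}. e_char ((v - of_int j) * y) * e_char (of_int j * x)) has_integral S v m x) ?I"
      unfolding S_def box_kernel_def
      by (intro has_integral_sum) (auto intro!: has_integral_mult_left integrable_integral
          integrable_continuous_interval continuous_intros)
    moreover have "(\<Sum>j\<in>{-int m..int m}. e_char ((v - of_int j) * y) * e_char (of_int j * x))
        = e_char (v * y) * D m (y - x)" for y
      unfolding D_def sum_distrib_left
      by (rule sum.cong) (simp_all flip: e_char_add add: algebra_simps)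
    ultimately show ?thesis by simp
  qed
  \<comment> \<open>With \<open>v = 0\<close> the partial sum is the integral of the Dirichlet kernel, which allows \<open>e_char (u * x)\<close> to be subtracted under the integral.\<close>
  have S0: "S 0 m x = 1" for m x
  proof -
    have "S 0 m x = (\<Sum>j\<in>{-int m..int m}. if j = 0 then 1 else 0)"
      unfolding S_def
      by (rule sum.cong) (use box_kernel_int[of "- j" for j] in \<open>auto simp flip: of_int_minus\<close>)
    then show ?thesis by simp
  qed
  have bound: "norm (S u m x - e_char (u * x)) \<le> 2 * C / real m" if "x \<in> {-r..r}" "m > 0" for m x
  proof -
    have cont: "continuous_on ?I (\<lambda>y. G (y - x) * e_char (w * (y - x)))" for w
      by (intro continuous_intros continuous_on_compose2[OF contG]) (use that r in auto)
    have "((\<lambda>y. e_char (u * y) * D m (y - x) - e_char (u * x) * (e_char (0 * y) * D m (y - x)))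
        has_integral (S u m x - e_char (u * x) * S 0 m x)) ?I"
      by (intro has_integral_diff has_integral_mult_right S_int)
    moreover have "e_char (u * y) * D m (y - x) - e_char (u * x) * (e_char (0 * y) * D m (y - x))
       = e_char (u * x) * (G (y - x) * e_char (real (Suc m) * (y - x)) - G (y - x) * e_char (- real m * (y - x)))"
      if "y \<in> ?I" for y
    proof -
      have "e_char (u * y) = e_char (u * x) * e_char (u * (y - x))"
        by (simp flip: e_char_add add: algebra_simps)
      then have "e_char (u * y) * D m (y - x) - e_char (u * x) * (e_char (0 * y) * D m (y - x))
         = e_char (u * x) * ((e_char (u * (y - x)) - 1) * D m (y - x))"
        by (simp add: algebra_simps)
      also have "e_char (u * (y - x)) - 1 = G (y - x) * (e_char (y - x) - 1)"
        by (rule G(3)) (use that \<open>x \<in> {-r..r}\<close> r in auto)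
      also have "G (y - x) * (e_char (y - x) - 1) * D m (y - x) =
          G (y - x) * (D m (y - x) * (e_char (y - x) - 1))" by simp
      also have "D m (y - x) * (e_char (y - x) - 1) =
          e_char (real (Suc m) * (y - x)) - e_char (- real m * (y - x))"
        unfolding D_def dirichlet_kernel_telescope by simp
      finally show ?thesis by (simp only: right_diff_distrib)
    qed
    ultimately have "((\<lambda>y. e_char (u * x) * (G (y - x) * e_char (real (Suc m) * (y - x)) - G (y - x) * e_char (- real m * (y - x))))
        has_integral (S u m x - e_char (u * x) * S 0 m x)) ?I"
      by (rule has_integral_eq[rotated]) auto
    moreover have "((\<lambda>y. e_char (u * x) * (G (y - x) * e_char (real (Suc m) * (y - x)) - G (y - x) * e_char (- real m * (y - x))))
        has_integral e_char (u * x) * (integral ?I (\<lambda>y. G (y - x) * e_char (real (Suc m) * (y - x))) -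
           integral ?I (\<lambda>y. G (y - x) * e_char (- real m * (y - x))))) ?I"
      by (intro has_integral_mult_right has_integral_diff integrable_integral integrable_continuous_interval cont)
    ultimately have "S u m x - e_char (u * x) = e_char (u * x) * (integral ?I (\<lambda>y. G (y - x) * e_char (real (Suc m) * (y - x))) -
           integral ?I (\<lambda>y. G (y - x) * e_char (- real m * (y - x))))"
      unfolding S0 mult_1_right by (rule has_integral_unique)
    then have "norm (S u m x - e_char (u * x)) \<le> norm (integral ?I (\<lambda>y. G (y - x) * e_char (real (Suc m) * (y - x))))
       + norm (integral ?I (\<lambda>y. G (y - x) * e_char (- real m * (y - x))))"
      by (simp only: norm_mult norm_e_char mult_1_left norm_triangle_ineq4)
    also have "\<dots> \<le> C / \<bar>real (Suc m)\<bar> + C / \<bar>- real m\<bar>"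
      by (intro add_mono C) (use that in auto)
    also have "\<dots> \<le> C / real m + C / real m"
      using C(1) that by (intro add_mono divide_left_mono) auto
    finally show ?thesis by simp
  qed
  show ?thesis
    unfolding S_def[symmetric]
  proof (rule uniform_limitI)
    fix e :: real assume e: "e > 0"
    have "(\<lambda>m. 2 * C / real m) \<longlonglongrightarrow> 0" by (rule lim_const_over_n)
    then have "\<forall>\<^sub>F m in sequentially. 2 * C / real m < e"
      using e by (rule order_tendstoD)
    then show "\<forall>\<^sub>F m in sequentially. \<forall>x\<in>{-r..r}. dist (S u m x) (e_char (u * x)) < e"
      using eventually_gt_at_top[of 0]
    proof eventually_elim
      case (elim m)
      then show ?case using bound[of _ m] by (force simp: dist_norm)
    qed
  qed
qed

text \<open>
  Averaging the expansion of \<open>e_char (u * (x - y))\<close> against \<open>e_char (u * y)\<close> over \<open>\<bar>y\<bar> \<le> a/2\<close>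
  reproduces \<open>e_char (u * x)\<close> and multiplies the \<open>j\<close>-th coefficient by \<open>box_kernel a (u - j)\<close>.
  So every average gains one order of decay of the kernel, and costs \<open>a/2\<close> of the range of \<open>x\<close>.
\<close>

lemma box_average_uniform_limit:
  fixes k :: "real \<Rightarrow> complex"
  assumes lim: "\<And>u. uniform_limit {-R..R}
     (\<lambda>m x. \<Sum>j\<in>{-int m..int m}. k (u - of_int j) * e_char (of_int j * x))
     (\<lambda>x. e_char (u * x)) sequentially"
    and a: "0 < a"
  shows "uniform_limit {-(R - a/2)..R - a/2}
     (\<lambda>m x. \<Sum>j\<in>{-int m..int m}. k (u - of_int j) * box_kernel a (u - of_int j) * e_char (of_int j * x))
     (\<lambda>x. e_char (u * x)) sequentially"
proof (rule uniform_limitI)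
  fix e :: real assume e: "e > 0"
  let ?I = "{-(a/2)..a/2}"
  define S where "S m x = (\<Sum>j\<in>{-int m..int m}. k (u - of_int j) * e_char (of_int j * x))" for m x
  define T where "T m x = (\<Sum>j\<in>{-int m..int m}. k (u - of_int j) * box_kernel a (u - of_int j) * e_char (of_int j * x))" for m x
  have "\<forall>\<^sub>F m in sequentially. \<forall>x\<in>{-R..R}. dist (S m x) (e_char (u * x)) < e/2"
    using lim[of u] e unfolding S_def by (intro uniform_limitD) auto
  then show "\<forall>\<^sub>F m in sequentially. \<forall>x\<in>{-(R - a/2)..R - a/2}. dist (T m x) (e_char (u * x)) < e"
  proof eventually_elim
    case (elim m)
    show ?case
    proof
      fix x assume x: "x \<in> {-(R - a/2)..R - a/2}"
      have "((\<lambda>y. \<Sum>j\<in>{-int m..int m}. k (u - of_int j) * (e_char ((u - of_int j) * y) / complex_of_real a) * e_char (of_int j * x))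
          has_integral T m x) ?I"
        unfolding T_def box_kernel_def
        by (intro has_integral_sum) (auto intro!: has_integral_mult_left has_integral_mult_right has_integral_divide integrable_integral
            integrable_continuous_interval continuous_intros)
      moreover have "(\<Sum>j\<in>{-int m..int m}. k (u - of_int j) * (e_char ((u - of_int j) * y) / complex_of_real a) * e_char (of_int j * x))
          = e_char (u * y) * S m (x - y) / complex_of_real a" for y
        unfolding S_def sum_distrib_left sum_divide_distrib
      proof (rule sum.cong[OF refl])
        fix j
        have "e_char ((u - of_int j) * y) * e_char (of_int j * x) = e_char (u * y) * e_char (of_int j * (x - y))"
          by (simp flip: e_char_add add: algebra_simps)
        then show "k (u - of_int j) * (e_char ((u - of_int j) * y) / complex_of_real a) * e_char (of_int j * x) =
           e_char (u * y) * (k (u - of_int j) * e_char (of_int j * (x - y))) / complex_of_real a"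
          by (simp add: mult_ac)
      qed
      ultimately have T: "((\<lambda>y. e_char (u * y) * S m (x - y) / complex_of_real a) has_integral T m x) ?I" by simp
      have "((\<lambda>y. e_char (u * x) / complex_of_real a) has_integral ((a/2 - (-(a/2))) *\<^sub>R (e_char (u * x) / complex_of_real a))) ?I"
        using has_integral_const_real[of "e_char (u * x) / complex_of_real a" "-(a/2)" "a/2"] a by simp
      then have "((\<lambda>y. e_char (u * x) / complex_of_real a) has_integral e_char (u * x)) ?I"
        using a by (simp add: scaleR_conv_of_real)
      note d = has_integral_diff[OF T this]
      have "norm (T m x - e_char (u * x)) \<le> (e/2 / a) * measure lborel ?I"
      proof (rule has_integral_bound_real[OF _ finite.emptyI d])
        show "0 \<le> e/2/a" using e a by simp
        fix y assume "y \<in> ?I - {}" then have y: "y \<in> ?I" by simp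
        have "e_char (u * x) = e_char (u * y) * e_char (u * (x - y))"
          by (simp flip: e_char_add add: algebra_simps)
        then have "e_char (u * y) * S m (x - y) / complex_of_real a - e_char (u * x) / complex_of_real a =
           e_char (u * y) * (S m (x - y) - e_char (u * (x - y))) / complex_of_real a"
          by (simp add: diff_divide_distrib right_diff_distrib)
        also have "norm \<dots> = dist (S m (x - y)) (e_char (u * (x - y))) / a"
          using a by (simp add: norm_mult norm_divide dist_norm)
        also have "\<dots> \<le> e/2 / a"
          using elim x y a by (intro divide_right_mono less_imp_le) auto
        finally show "norm (e_char (u * y) * S m (x - y) / complex_of_real a - e_char (u * x) / complex_of_real a) \<le> e/2/a" .
      qed
      also have "\<dots> < e" using a e by simp
      finally show "dist (T m x) (e_char (u * x)) < e" by (simp add: dist_norm)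
    qed
  qed
qed

lemma summable_on_int_bracket:
  assumes "q < -1"
  shows "(\<lambda>j::int. bracket (real_of_int j) powr q) summable_on UNIV"
proof -
  have "summable (\<lambda>n. of_nat (n + 1) powr q :: real)"
    using assms summable_real_powr_iff[of q]
    by (intro summable_ignore_initial_segment) auto
  then have nat: "(\<lambda>n::nat. (1 + real n) powr q) summable_on UNIV"
    by (intro norm_summable_imp_summable_on) (simp add: add.commute)
  have inj: "inj (\<lambda>n. - int n)" by (rule injI) simp
  have 1: "(\<lambda>j::int. bracket (real_of_int j) powr q) summable_on (range int)"
    using nat by (subst summable_on_reindex) (simp_all add: o_def bracket_def)
  have 2: "(\<lambda>j::int. bracket (real_of_int j) powr q) summable_on (range (\<lambda>n. - int n))"
    using nat by (subst summable_on_reindex[OF inj]) (simp add: o_def bracket_def)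
  have "j \<in> range int \<union> range (\<lambda>n. - int n)" for j :: int
    by (cases j rule: int_cases2) auto
  then have "range int \<union> range (\<lambda>n. - int n) = UNIV" by blast
  then show ?thesis using summable_on_union[OF 1 2] by simp
qed

text \<open>
  A kernel that decays faster than \<open>1 / \<bar>v\<bar>\<close> can be summed over every translate of the integers, not only
  over the integers themselves: Peetre's inequality removes the translation.
\<close>

lemma summable_on_int_translates:
  fixes \<kappa> :: "real \<Rightarrow> complex"
  assumes C: "0 \<le> C" and q: "q < -1" and \<kappa>: "\<And>v. norm (\<kappa> v) \<le> C * bracket v powr q"
  shows "(\<lambda>j. norm (\<kappa> (u - of_int j))) summable_on UNIV"
proof (rule summable_on_comparison_test)
  show "(\<lambda>j. C * bracket u powr \<bar>q\<bar> * bracket (real_of_int j) powr q) summable_on UNIV"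
    by (intro summable_on_cmult_right summable_on_int_bracket q)
  fix j :: int
  have "norm (\<kappa> (u - of_int j)) \<le> C * bracket (u - of_int j) powr q" by (rule \<kappa>)
  also have "\<dots> \<le> C * (bracket (- real_of_int j) powr q * bracket u powr \<bar>q\<bar>)"
    using peetre_inequality[of "- real_of_int j" u q] C by (intro mult_left_mono) simp_all
  finally show "norm (\<kappa> (u - of_int j)) \<le> C * bracket u powr \<bar>q\<bar> * bracket (real_of_int j) powr q"
    by (simp add: bracket_def mult_ac)
qed auto

text \<open>
  The kernel is the cardinal sine times \<open>N\<close> box kernels of width \<open>\<delta> / N\<close>, modulated so that the
  range of validity is centred at \<open>1/2\<close>. The plain sampling series is valid on
  \<open>\<bar>x\<bar> \<le> 1/2 - \<delta>/2\<close>, and the \<open>N\<close> averages together use up the remaining \<open>\<delta>/2\<close>. Room between the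
  support and the boundary of the unit interval is thus traded for arbitrarily fast decay.
\<close>

lemma sampling_kernel_1d:
  fixes \<delta> :: real and N :: nat
  assumes \<delta>: "0 < \<delta>" "\<delta> < 1/2" and N: "2 \<le> N"
  obtains \<kappa> :: "real \<Rightarrow> complex" and C where
    "0 \<le> C"
    "\<And>v. norm (\<kappa> v) \<le> C * bracket v powr (- real N)"
    "\<And>u x. x \<in> {\<delta>..1 - \<delta>} \<Longrightarrow>
       ((\<lambda>j. \<kappa> (u - of_int j) * e_char (- (of_int j * x))) has_sum e_char (- (u * x))) UNIV"
proof -
  \<comment> \<open>The total loss of range is N * (a/2), which this choice makes equal to \<open>\<delta>/2\<close>.\<close>
  define a where "a = \<delta> / N"
  have a: "0 < a" using \<delta> N by (simp add: a_def)
  define r where "r = 1/2 - \<delta>/2"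
  define k where "k n v = box_kernel 1 v * box_kernel a v ^ n" for n v
  \<comment> \<open>The cardinal sine series, averaged \<open>n\<close> times.\<close>
  have iter: "uniform_limit {-(r - n * (a/2))..r - n * (a/2)}
     (\<lambda>m x. \<Sum>j\<in>{-int m..int m}. k n (u - of_int j) * e_char (of_int j * x))
     (\<lambda>x. e_char (u * x)) sequentially" for n :: nat and u :: real
  proof (induction n arbitrary: u)
    case 0
    then show ?case using box_series_uniform_limit[of r u] \<delta> by (simp add: k_def r_def)
  next
    case (Suc n)
    have "k (Suc n) v = k n v * box_kernel a v" for v by (simp add: k_def)
    moreover have "r - real n * (a/2) - a/2 = r - real (Suc n) * (a/2)" by (simp add: algebra_simps)
    ultimately show ?case using box_average_uniform_limit[OF Suc.IH a, of u] by (simp only:)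
  qed
  have rN: "r - real N * (a/2) = 1/2 - \<delta>" using N by (simp add: r_def a_def)
  define B where "B = 1 + 1 / (pi * a)"
  have B: "0 \<le> B" using a by (simp add: B_def)
  have k_bound: "norm (k N v) \<le> B ^ N * bracket v powr (- real N)" for v
  proof -
    have "norm (k N v) \<le> 1 * (B / (1 + \<bar>v\<bar>)) ^ N"
      unfolding k_def norm_mult norm_power B_def
      by (intro mult_mono norm_box_kernel_le_1 power_mono norm_box_kernel_decay a) auto
    then show ?thesis
      unfolding powr_minus_divide powr_realpow[OF bracket_pos] by (simp add: power_divide bracket_def)
  qed
  define \<kappa> where "\<kappa> v = e_char (- (v * (1/2))) * k N v" for v
  have \<kappa>_bound: "norm (\<kappa> v) \<le> B ^ N * bracket v powr (- real N)" for v
    using k_bound[of v] by (simp add: \<kappa>_def norm_mult)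
  show thesis
  proof
    show "0 \<le> B ^ N" using B by simp
    show "norm (\<kappa> v) \<le> B ^ N * bracket v powr (- real N)" for v by (rule \<kappa>_bound)
    fix u x :: real assume x: "x \<in> {\<delta>..1 - \<delta>}"
    define F where "F j = \<kappa> (u - of_int j) * e_char (- (of_int j * x))" for j
    have "(\<lambda>j. norm (\<kappa> (u - of_int j))) summable_on UNIV"
      by (rule summable_on_int_translates[OF _ _ \<kappa>_bound]) (use B N in auto)
    then have "(\<lambda>j. norm (F j)) summable_on UNIV" by (simp add: F_def norm_mult)
    then have "F summable_on UNIV" by (rule abs_summable_summable)
    then have hs: "(F has_sum infsum F UNIV) UNIV" by (rule has_sum_infsum)
    have "filterlim (\<lambda>m. {-int m..int m}) (finite_subsets_at_top UNIV) sequentially"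
      unfolding filterlim_finite_subsets_at_top
    proof (intro allI impI)
      fix X :: "int set" assume "finite X \<and> X \<subseteq> UNIV"
      then have "finite (insert 0 (abs ` X))" by simp
      then have M: "\<bar>j\<bar> \<le> Max (insert 0 (abs ` X))" if "j \<in> X" for j
        using that by (intro Max_ge) auto
      show "\<forall>\<^sub>F m in sequentially. finite {- int m..int m} \<and> X \<subseteq> {- int m..int m} \<and> {- int m..int m} \<subseteq> UNIV"
        using eventually_ge_at_top[of "nat (Max (insert 0 (abs ` X)))"]
        
      proof eventually_elim
        case (elim m)
        have "- int m \<le> j \<and> j \<le> int m" if "j \<in> X" for j
          using M[OF that] elim by linarith
        then show ?case by auto
      qed
    qed
    then have lim1: "(\<lambda>m. \<Sum>j\<in>{-int m..int m}. F j) \<longlonglongrightarrow> infsum F UNIV"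
      using hs unfolding has_sum_def by (rule filterlim_compose[rotated])
    have "(\<lambda>m. \<Sum>j\<in>{-int m..int m}. k N (u - of_int j) * e_char (of_int j * (1/2 - x))) \<longlonglongrightarrow> e_char (u * (1/2 - x))"
      using iter[of N u] unfolding rN by (rule tendsto_uniform_limitI) (use x in auto)
    then have "(\<lambda>m. e_char (- (u/2)) * (\<Sum>j\<in>{-int m..int m}. k N (u - of_int j) * e_char (of_int j * (1/2 - x))))
        \<longlonglongrightarrow> e_char (- (u/2)) * e_char (u * (1/2 - x))"
      by (intro tendsto_intros)
    also have "e_char (- (u/2)) * e_char (u * (1/2 - x)) = e_char (- (u * x))"
      by (simp flip: e_char_add add: algebra_simps)
    also have "(\<lambda>m. e_char (- (u/2)) * (\<Sum>j\<in>{-int m..int m}. k N (u - of_int j) * e_char (of_int j * (1/2 - x)))) =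
       (\<lambda>m. \<Sum>j\<in>{-int m..int m}. F j)"
    proof -
      have "e_char (- (u/2)) * (k N (u - of_int j) * e_char (of_int j * (1/2 - x))) = F j" for j
      proof -
        have "e_char (- (u/2)) * e_char (of_int j * (1/2 - x)) =
            e_char (- ((u - of_int j) * (1/2))) * e_char (- (of_int j * x))"
          unfolding e_char_add[symmetric] by (rule arg_cong[where f = e_char]) (simp add: field_simps)
        then show ?thesis by (simp add: F_def \<kappa>_def mult_ac)
      qed
      then show ?thesis by (simp add: sum_distrib_left)
    qed
    finally have "infsum F UNIV = e_char (- (u * x))"
      using LIMSEQ_unique[OF lim1] by blast
    with hs have "(F has_sum e_char (- (u * x))) UNIV" by simp
    then show "((\<lambda>j. \<kappa> (u - of_int j) * e_char (- (of_int j * x))) has_sum e_char (- (u * x))) UNIV"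
      unfolding F_def[abs_def] .
  qed
qed

section \<open>Sampling on Euclidean space\<close>

text \<open>
  A sum of a nonnegative product over finitely many functions is at most the sum over the product
  of their ranges, which factorises.
\<close>

lemma summable_on_prod_fun:
  fixes f :: "'n::finite \<Rightarrow> 'b \<Rightarrow> real"
  assumes f: "\<And>i. f i summable_on UNIV" and nonneg: "\<And>i x. 0 \<le> f i x"
  shows "(\<lambda>g::'n \<Rightarrow> 'b. \<Prod>i\<in>UNIV. f i (g i)) summable_on UNIV"
proof (rule nonneg_bdd_above_summable_on)
  show "bdd_above (sum (\<lambda>g. \<Prod>i\<in>UNIV. f i (g i)) ` {F. F \<subseteq> UNIV \<and> finite F})"
  proof (rule bdd_aboveI2)
    fix F :: "('n \<Rightarrow> 'b) set" assume "F \<in> {F. F \<subseteq> UNIV \<and> finite F}"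
    then have F: "finite F" by simp
    define A where "A i = (\<lambda>g. g i) ` F" for i
    have A: "finite (A i)" for i using F by (simp add: A_def)
    have "(\<Sum>g\<in>F. \<Prod>i\<in>UNIV. f i (g i)) \<le> (\<Sum>g\<in>PiE UNIV A. \<Prod>i\<in>UNIV. f i (g i))"
      by (intro sum_mono2 finite_PiE prod_nonneg A) (auto simp: A_def nonneg)
    also have "\<dots> = (\<Prod>i\<in>UNIV. sum (f i) (A i))"
      by (subst prod_sum_PiE) (use A in auto)
    also have "\<dots> \<le> (\<Prod>i\<in>UNIV. infsum (f i) UNIV)"
      by (intro prod_mono conjI sum_nonneg finite_sum_le_infsum f A) (auto simp: nonneg)
    finally show "(\<Sum>g\<in>F. \<Prod>i\<in>UNIV. f i (g i)) \<le> (\<Prod>i\<in>UNIV. infsum (f i) UNIV)" .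
  qed
qed (auto intro!: prod_nonneg nonneg)

lemma has_sum_prod_fun:
  fixes f :: "'n::finite \<Rightarrow> 'b \<Rightarrow> complex"
  assumes f: "\<And>i. (\<lambda>x. norm (f i x)) summable_on UNIV" and s: "\<And>i. (f i has_sum s i) UNIV"
  shows "((\<lambda>g::'n \<Rightarrow> 'b. \<Prod>i\<in>UNIV. f i (g i)) has_sum (\<Prod>i\<in>UNIV. s i)) UNIV"
proof -
  have summ: "(\<lambda>g::'n \<Rightarrow> 'b. norm (\<Prod>i\<in>UNIV. f i (g i))) summable_on UNIV"
    using summable_on_prod_fun[of "\<lambda>i x. norm (f i x)"] f unfolding prod_norm[symmetric] by simp
  have "((\<lambda>g::'n \<Rightarrow> 'b. \<Prod>i\<in>UNIV. f i (g i)) has_sum (infsum (\<lambda>g. \<Prod>i\<in>UNIV. f i (g i)) UNIV)) UNIV"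
    by (rule has_sum_infsum[OF abs_summable_summable[OF summ]])
  also have "infsum (\<lambda>g. \<Prod>i\<in>UNIV. f i (g i)) UNIV = (\<Prod>i\<in>UNIV. infsum (f i) UNIV)"
    using infsum_prod_PiE_abs[of "UNIV :: 'n set" f "\<lambda>_. UNIV"] f by (simp only: PiE_UNIV_domain Pi_UNIV finite UNIV_I)
  also have "\<dots> = (\<Prod>i\<in>UNIV. s i)"
    by (intro prod.cong refl infsumI s)
  finally show ?thesis .
qed

definition lattice_pt :: "('n \<Rightarrow> int) \<Rightarrow> real ^ 'n" where
  "lattice_pt j = (\<chi> i. of_int (j i))"

lemma lattice_pt_nth [simp]: "lattice_pt j $ i = of_int (j i)" by (simp add: lattice_pt_def)

lemma lattice_pt_diff: "lattice_pt k - lattice_pt j = lattice_pt (k - j)"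
  by (simp add: vec_eq_iff)

text \<open>
  The product form factorises over coordinates, so that its sum over the lattice is a power of a
  one-dimensional sum, in every dimension.
\<close>

definition prod_decay :: "real ^ 'n \<Rightarrow> real" where
  "prod_decay v = (\<Prod>i\<in>UNIV. bracket (v $ i) powr (-2))"

lemma prod_decay_nonneg [simp]: "0 \<le> prod_decay v"
  by (simp add: prod_decay_def prod_nonneg)

lemma prod_decay_translate:
  assumes "\<And>i. \<bar>w $ i\<bar> \<le> 1"
  shows "prod_decay (v + w) \<le> 4 ^ CARD('n) * prod_decay (v :: real ^ 'n)"
proof -
  have "prod_decay (v + w) \<le> (\<Prod>i\<in>(UNIV::'n set). 4 * bracket (v $ i) powr (-2))"
    unfolding prod_decay_def
  proof (intro prod_mono conjI)
    fix i
    have "bracket ((v + w) $ i) powr (-2) \<le> bracket (v $ i) powr (-2) * bracket (w $ i) powr \<bar>-2\<bar>"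
      by (simp only: vector_add_component peetre_inequality)
    also have "\<dots> \<le> bracket (v $ i) powr (-2) * 2 powr \<bar>-2\<bar>"
      using assms[of i] by (intro mult_left_mono powr_mono2) (auto simp: bracket_def)
    finally show "bracket ((v + w) $ i) powr (-2) \<le> 4 * bracket (v $ i) powr (-2)" by simp
  qed simp
  also have "\<dots> = 4 ^ CARD('n) * prod_decay v"
    by (simp add: prod.distrib prod_decay_def)
  finally show ?thesis .
qed

lemma summable_on_prod_bracket:
  assumes "q < -1"
  shows "(\<lambda>j :: 'n::finite \<Rightarrow> int. \<Prod>i\<in>UNIV. bracket (real_of_int (j i)) powr q) summable_on UNIV"
  by (rule summable_on_prod_fun) (use summable_on_int_bracket[OF assms] in auto)

lemma prod_decay_summable:
  "(\<lambda>j. prod_decay (lattice_pt j :: real ^ 'n)) summable_on UNIV"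
  using summable_on_prod_bracket[of "-2", where 'n = 'n] by (simp add: prod_decay_def)

lemma bij_reflect: "bij (\<lambda>j :: 'n \<Rightarrow> int. k - j)"
  by (rule bij_betw_byWitness[where f' = "\<lambda>j. k - j"]) auto

lemma prod_decay_summable_reflect:
  "(\<lambda>j. prod_decay (lattice_pt (k - j) :: real ^ 'n)) summable_on UNIV"
  "infsum (\<lambda>j. prod_decay (lattice_pt (k - j) :: real ^ 'n)) UNIV = infsum (\<lambda>j. prod_decay (lattice_pt j :: real ^ 'n)) UNIV"
  using summable_on_reindex_bij_betw[OF bij_reflect[of k], of "\<lambda>j. prod_decay (lattice_pt j :: real ^ 'n)"]
    infsum_reindex_bij_betw[OF bij_reflect[of k], of "\<lambda>j. prod_decay (lattice_pt j :: real ^ 'n)"]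
    prod_decay_summable by auto

text \<open>
  Expanding the product, the left-hand side consists of the terms of degree at most one.
\<close>

lemma one_plus_sum_le_prod:
  fixes a :: "'i \<Rightarrow> real"
  assumes "\<And>i. 0 \<le> a i"
  shows "1 + sum a I \<le> (\<Prod>i\<in>I. 1 + a i)"
proof (induction I rule: infinite_finite_induct)
  case (insert i I)
  have "1 + sum a (insert i I) = (1 + sum a I) + a i * 1" using insert by simp
  also have "\<dots> \<le> (1 + sum a I) + a i * (1 + sum a I)"
    using assms by (intro add_left_mono mult_left_mono) (auto intro!: sum_nonneg)
  also have "\<dots> = (1 + a i) * (1 + sum a I)" by (simp add: algebra_simps)
  also have "\<dots> \<le> (1 + a i) * (\<Prod>i\<in>I. 1 + a i)"
    using assms insert by (intro mult_left_mono) (auto intro!: add_nonneg_nonneg)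
  finally show ?case using insert by simp
qed auto

lemma bracket_le_prod: "bracket (v :: real ^ 'n) \<le> (\<Prod>i\<in>UNIV. bracket (v $ i))"
proof -
  have "bracket v \<le> 1 + (\<Sum>i\<in>UNIV. \<bar>v $ i\<bar>)" by (simp add: bracket_def norm_le_l1_cart)
  also have "\<dots> \<le> (\<Prod>i\<in>UNIV. bracket (v $ i))"
    unfolding bracket_def using one_plus_sum_le_prod[of "\<lambda>i. \<bar>v $ i\<bar>" UNIV] by simp
  finally show ?thesis .
qed

lemma e_char_sum: "e_char (sum f I) = (\<Prod>i\<in>I. e_char (f i))"
  by (induction I rule: infinite_finite_induct) (auto simp: e_char_add)

text \<open>
  The tensor product of one-dimensional kernels of order \<open>m + 2\<close>: two orders of decay in each variable
  go into the summable factor, and the others dominate \<open>bracket v powr (- m)\<close>, since \<open>bracket v\<close>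
  is at most the product of the brackets of the coordinates. The factor \<open>bracket v powr (- m)\<close> will
  absorb the growth of the weights in Peetre's inequality.
\<close>

lemma sampling_kernel:
  fixes \<delta> :: real and m :: nat
  assumes \<delta>: "0 < \<delta>" "\<delta> < 1/2"
  obtains K :: "real ^ 'n \<Rightarrow> complex" and C where
    "0 \<le> C"
    "\<And>v. norm (K v) \<le> C * prod_decay v * bracket v powr (- real m)"
    "\<And>z x. \<forall>i. \<delta> \<le> x $ i \<and> x $ i \<le> 1 - \<delta> \<Longrightarrow>
       ((\<lambda>j. K (z - lattice_pt j) * e_char (- (lattice_pt j \<bullet> x))) has_sum e_char (- (z \<bullet> x))) UNIV"
proof -
  obtain \<kappa> :: "real \<Rightarrow> complex" and C where C: "0 \<le> C"
    and \<kappa>: "\<And>v. norm (\<kappa> v) \<le> C * bracket v powr (- real (m + 2))"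
    and rep: "\<And>u x. x \<in> {\<delta>..1 - \<delta>} \<Longrightarrow>
       ((\<lambda>j. \<kappa> (u - of_int j) * e_char (- (of_int j * x))) has_sum e_char (- (u * x))) UNIV"
    by (rule sampling_kernel_1d[OF \<delta>, of "m + 2"]) (simp, rule that)
  have \<kappa>': "norm (\<kappa> v) \<le> C * bracket v powr (-2) * bracket v powr (- real m)" for v
  proof -
    have "bracket v powr (- real (m + 2)) = bracket v powr (-2) * bracket v powr (- real m)"
      by (simp flip: powr_add)
    then show ?thesis using \<kappa>[of v] by (simp only: mult.assoc)
  qed
  have \<kappa>_summable: "(\<lambda>j. norm (\<kappa> (u - of_int j))) summable_on UNIV" for u
    by (rule summable_on_int_translates[OF C _ \<kappa>]) simp
  define K :: "real ^ 'n \<Rightarrow> complex" where "K v = (\<Prod>i\<in>UNIV. \<kappa> (v $ i))" for v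
  show thesis
  proof
    show "0 \<le> C ^ CARD('n)" using C by simp
    fix v :: "real ^ 'n"
    have "norm (K v) = (\<Prod>i\<in>UNIV. norm (\<kappa> (v $ i)))" by (simp add: K_def prod_norm)
    also have "\<dots> \<le> (\<Prod>i\<in>UNIV. C * bracket (v $ i) powr (-2) * bracket (v $ i) powr (- real m))"
      by (intro prod_mono conjI \<kappa>') auto
    also have "\<dots> = C ^ CARD('n) * prod_decay v * (\<Prod>i\<in>UNIV. bracket (v $ i)) powr (- real m)"
      by (simp add: prod.distrib prod_decay_def prod_powr_distrib)
    also have "\<dots> \<le> C ^ CARD('n) * prod_decay v * bracket v powr (- real m)"
      using C by (intro mult_left_mono powr_mono2' bracket_le_prod) auto
    finally show "norm (K v) \<le> C ^ CARD('n) * prod_decay v * bracket v powr (- real m)" .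
  next
    fix z x :: "real ^ 'n" assume x: "\<forall>i. \<delta> \<le> x $ i \<and> x $ i \<le> 1 - \<delta>"
    have "((\<lambda>j. \<Prod>i\<in>UNIV. \<kappa> (z $ i - of_int (j i)) * e_char (- (of_int (j i) * x $ i))) has_sum
        (\<Prod>i\<in>UNIV. e_char (- (z $ i * x $ i)))) UNIV"
      by (rule has_sum_prod_fun[where f = "\<lambda>i j. \<kappa> (z $ i - of_int j) * e_char (- (of_int j * x $ i))"])
         (use x \<kappa>_summable in \<open>auto intro!: rep simp: norm_mult\<close>)
    then show "((\<lambda>j. K (z - lattice_pt j) * e_char (- (lattice_pt j \<bullet> x))) has_sum e_char (- (z \<bullet> x))) UNIV"
      by (simp add: K_def inner_vec_def prod.distrib flip: e_char_sum sum_negf)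
  qed
qed

text \<open>
  Jensen's inequality for \<open>x powr p\<close> with the weights \<open>a i\<close>. The proof applies Young's inequality
  to \<open>y i * M powr (p - 1)\<close>, where \<open>M\<close> is the weighted mean of \<open>y\<close>, and sums over \<open>i\<close>.
\<close>

lemma weighted_power_mean:
  fixes a y :: "'i \<Rightarrow> real"
  assumes p: "1 < p" and a: "\<And>i. i \<in> I \<Longrightarrow> 0 \<le> a i" and y: "\<And>i. i \<in> I \<Longrightarrow> 0 \<le> y i"
  shows "(\<Sum>i\<in>I. a i * y i) powr p \<le> (sum a I) powr (p - 1) * (\<Sum>i\<in>I. a i * y i powr p)"
proof (cases "(\<Sum>i\<in>I. a i * y i) = 0")
  case True
  then show ?thesis using a p by (auto intro!: mult_nonneg_nonneg sum_nonneg)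
next
  case False
  define A where "A = sum a I"
  define S where "S = (\<Sum>i\<in>I. a i * y i)"
  define T where "T = (\<Sum>i\<in>I. a i * y i powr p)"
  have S: "0 < S" using False a y by (auto simp: S_def less_le intro!: sum_nonneg)
  have A0: "0 \<le> A" using a by (auto simp: A_def intro!: sum_nonneg)
  have "A \<noteq> 0"
  proof
    assume "A = 0"
    show False
    proof (cases "finite I")
      case True
      then have "\<forall>i\<in>I. a i = 0" using \<open>A = 0\<close> a unfolding A_def by (subst (asm) sum_nonneg_eq_0_iff) auto
      then show False using S by (simp add: S_def)
    qed (use S in \<open>simp add: S_def\<close>)
  qed
  with A0 have A: "0 < A" by simp
  define M where "M = S / A"
  have M: "0 < M" using S A by (simp add: M_def)
  define q where "q = p / (p - 1)"
  have q: "1 < q" "1 / p + 1 / q = 1" using p by (auto simp: q_def field_simps)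
  have young: "y i * M powr (p - 1) \<le> y i powr p / p + M powr p / q" if "i \<in> I" for i
    using Youngs_inequality[OF p q(1) q(2) y[OF that], of "M powr (p - 1)"] p
    by (simp add: powr_powr q_def)
  have "S * M powr (p - 1) = (\<Sum>i\<in>I. a i * (y i * M powr (p - 1)))"
    by (simp add: S_def sum_distrib_right mult.assoc)
  also have "\<dots> \<le> (\<Sum>i\<in>I. a i * (y i powr p / p + M powr p / q))"
    by (intro sum_mono mult_left_mono young a)
  also have "\<dots> = T / p + A * M powr p / q"
    by (simp add: T_def A_def distrib_left sum.distrib sum_distrib_right sum_divide_distrib)
  finally have *: "S * M powr (p - 1) \<le> T / p + A * M powr p / q" .
  have "S * M powr (p - 1) = A * M powr p"
    using A M by (simp add: M_def powr_diff field_simps)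
  moreover have "A * M powr p = A * M powr p / p + A * M powr p / q"
    using q(2) by (metis add_divide_distrib distrib_left mult.right_neutral times_divide_eq_right)
  ultimately have "A * M powr p / p \<le> T / p" using * by linarith
  then have "A * M powr p \<le> T" using p by (simp add: divide_le_cancel)
  then have "A powr (p - 1) * (A * M powr p) \<le> A powr (p - 1) * T" by (intro mult_left_mono) auto
  moreover have "A powr (p - 1) * (A * M powr p) = S powr p"
    using A S by (simp add: M_def powr_divide powr_diff)
  ultimately show ?thesis by (simp add: S_def A_def T_def)
qed

section \<open>Fourier transforms of measures on the unit cube\<close>

text \<open>
  By the Lindelof property the complement of the support, a union of open null sets, is the union
  of countably many of them.
\<close>

lemma AE_in_measure_support:
  fixes \<mu> :: "'a::second_countable_topology measure"
  assumes sets: "sets \<mu> = sets borel"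
  shows "AE x in \<mu>. x \<in> measure_support \<mu>"
proof -
  define \<U> where "\<U> = {U :: 'a set. open U \<and> emeasure \<mu> U = 0}"
  have "\<And>U. U \<in> \<U> \<Longrightarrow> open U" by (simp add: \<U>_def)
  then obtain \<V> where \<V>: "\<V> \<subseteq> \<U>" "countable \<V>" "\<Union>\<V> = \<Union>\<U>" using Lindelof by metis
  have null: "U \<in> null_sets \<mu>" if "U \<in> \<V>" for U
  proof -
    have "open U" "emeasure \<mu> U = 0" using that \<V>(1) by (auto simp: \<U>_def)
    then show ?thesis using sets by auto
  qed
  have "(\<Union>U\<in>\<V>. U) \<in> null_sets \<mu>"
    by (rule null_sets_UN') (use \<V> null in auto)
  then have "AE x in \<mu>. x \<notin> \<Union>\<U>" using \<V>(3) by (intro AE_not_in) simp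
  then show ?thesis
  proof (rule AE_mp, intro AE_I2 impI)
    fix x assume x: "x \<notin> \<Union>\<U>"
    then show "x \<in> measure_support \<mu>"
      unfolding measure_support_def \<U>_def by (auto simp: zero_less_iff_neq_zero)
  qed
qed

text \<open>
  The support condition in the almost-everywhere form in which it is used under integrals.
\<close>

definition cube_measure :: "real \<Rightarrow> (real ^ 'n) measure \<Rightarrow> bool" where
  "cube_measure \<delta> \<mu> \<longleftrightarrow> finite_measure \<mu> \<and> sets \<mu> = sets borel \<and>
     (AE x in \<mu>. \<forall>i. \<delta> \<le> x $ i \<and> x $ i \<le> 1 - \<delta>)"

lemma cube_measureI:
  assumes "finite_measure \<mu>" "sets \<mu> = sets borel"
    and "measure_support \<mu> \<subseteq> {x. \<forall>i. \<delta> \<le> x $ i \<and> x $ i \<le> 1 - \<delta>}"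
  shows "cube_measure \<delta> \<mu>"
  unfolding cube_measure_def
  using assms AE_in_measure_support[OF assms(2)] by (auto elim!: AE_mp)

lemma integral_norm_bound_AE:
  fixes g :: "'a \<Rightarrow> complex"
  assumes "finite_measure \<mu>" and "AE x in \<mu>. norm (g x) \<le> B" and "0 \<le> B"
  shows "norm (LINT x|\<mu>. g x) \<le> B * measure \<mu> (space \<mu>)"
proof (cases "integrable \<mu> g")
  case True
  interpret finite_measure \<mu> by fact
  have "norm (LINT x|\<mu>. g x) \<le> (LINT x|\<mu>. norm (g x))" by (rule integral_norm_bound)
  also have "\<dots> \<le> (LINT x|\<mu>. B)" using True assms by (intro integral_mono_AE) auto
  finally show ?thesis by (simp add: mult.commute)
qed (use assms in \<open>simp add: not_integrable_integral_eq\<close>)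

lemma norm_e_char_diff_le: "norm (e_char s - e_char t) \<le> 2 * pi * \<bar>s - t\<bar>"
proof -
  have "e_char s - e_char t = e_char t * (e_char (s - t) - 1)"
    by (simp add: right_diff_distrib flip: e_char_add)
  then have "norm (e_char s - e_char t) = norm (exp (\<i> * complex_of_real (2 * pi * (s - t))) - 1)"
    by (simp add: norm_mult e_char_def cis_conv_exp)
  also have "\<dots> = 2 * \<bar>sin (2 * pi * (s - t) / 2)\<bar>"
    using dist_exp_i_1[of "2 * pi * (s - t)"] by simp
  also have "\<dots> \<le> 2 * \<bar>2 * pi * (s - t) / 2\<bar>"
    by (intro mult_left_mono abs_sin_x_le_abs_x) auto
  finally show ?thesis by (simp add: abs_mult)
qed

context
  fixes \<mu> :: "(real ^ 'n) measure" and \<delta> :: real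
  assumes \<mu>: "cube_measure \<delta> \<mu>" and \<delta>: "0 < \<delta>" "\<delta> < 1/2"
begin

lemma cube_measure_finite: "finite_measure \<mu>" using \<mu> by (simp add: cube_measure_def)

lemma cube_measure_AE: "AE x in \<mu>. \<forall>i. \<delta> \<le> x $ i \<and> x $ i \<le> 1 - \<delta>" using \<mu> by (simp add: cube_measure_def)

lemma integrable_character: "integrable \<mu> (\<lambda>x. e_char (- (z \<bullet> x)))"
proof -
  interpret finite_measure \<mu> by (rule cube_measure_finite)
  have "(\<lambda>x. e_char (- (z \<bullet> x))) \<in> borel_measurable borel"
    by (intro borel_measurable_continuous_onI continuous_intros)
  then have "(\<lambda>x. e_char (- (z \<bullet> x))) \<in> borel_measurable \<mu>"
    using \<mu> by (simp add: cube_measure_def cong: measurable_cong_sets)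
  then show ?thesis by (intro integrable_const_bound[where B = 1]) auto
qed

lemma fourier_transform_e_char: "fourier_transform \<mu> z = (LINT x|\<mu>. e_char (- (z \<bullet> x)))"
  unfolding fourier_transform_def
  by (rule Bochner_Integration.integral_cong) (auto simp: e_char_def cis_conv_exp mult_ac)

lemma fourier_transform_0: "fourier_transform \<mu> 0 = complex_of_real (measure \<mu> (space \<mu>))"
  by (simp add: fourier_transform_e_char scaleR_conv_of_real)

lemma norm_fourier_transform_le: "norm (fourier_transform \<mu> z) \<le> norm (fourier_transform \<mu> 0)"
  unfolding fourier_transform_0 fourier_transform_e_char
  using integral_norm_bound_AE[OF cube_measure_finite, of "\<lambda>x. e_char (- (z \<bullet> x))" 1] by simp

text \<open>
  Besides continuity this shows that the transform keeps at least half of its value at the origin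
  on a ball whose radius depends only on the dimension; here it matters that the measure lives in
  the unit cube, where \<open>norm x\<close> is at most the dimension.
\<close>

lemma fourier_transform_lipschitz:
  "norm (fourier_transform \<mu> z - fourier_transform \<mu> w)
     \<le> 2 * pi * real CARD('n) * norm (z - w) * norm (fourier_transform \<mu> 0)"
proof -
  have "norm (fourier_transform \<mu> z - fourier_transform \<mu> w)
      = norm (LINT x|\<mu>. e_char (- (z \<bullet> x)) - e_char (- (w \<bullet> x)))"
    by (simp add: fourier_transform_e_char integrable_character)
  also have "\<dots> \<le> 2 * pi * real CARD('n) * norm (z - w) * measure \<mu> (space \<mu>)"
  proof (rule integral_norm_bound_AE[OF cube_measure_finite])
    show "AE x in \<mu>. norm (e_char (- (z \<bullet> x)) - e_char (- (w \<bullet> x))) \<le> 2 * pi * real CARD('n) * norm (z - w)"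
      using cube_measure_AE
    proof (rule AE_mp, intro AE_I2 impI)
      fix x :: "real ^ 'n" assume x: "\<forall>i. \<delta> \<le> x $ i \<and> x $ i \<le> 1 - \<delta>"
      have "norm x \<le> (\<Sum>i\<in>UNIV. \<bar>x $ i\<bar>)" by (rule norm_le_l1_cart)
      also have "\<dots> \<le> (\<Sum>i\<in>(UNIV::'n set). 1)" 
      proof (rule sum_mono)
        fix i show "\<bar>x $ i\<bar> \<le> 1" using x[rule_format, of i] \<delta> by linarith
      qed
      finally have nx: "norm x \<le> real CARD('n)" by simp
      have "norm (e_char (- (z \<bullet> x)) - e_char (- (w \<bullet> x))) \<le> 2 * pi * \<bar>(z - w) \<bullet> x\<bar>"
        by (rule order_trans[OF norm_e_char_diff_le]) (simp add: inner_diff_left)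
      also have "\<dots> \<le> 2 * pi * (norm (z - w) * norm x)"
        by (intro mult_left_mono Cauchy_Schwarz_ineq2) auto
      also have "\<dots> \<le> 2 * pi * (norm (z - w) * real CARD('n))"
        by (intro mult_left_mono nx) auto
      finally show "norm (e_char (- (z \<bullet> x)) - e_char (- (w \<bullet> x))) \<le> 2 * pi * real CARD('n) * norm (z - w)"
        by (simp add: mult_ac)
    qed
  qed auto
  finally show ?thesis by (simp add: fourier_transform_0)
qed

lemma continuous_fourier_transform: "continuous_on UNIV (fourier_transform \<mu>)"
proof -
  have "(2 * pi * real CARD('n) * norm (fourier_transform \<mu> 0))-lipschitz_on UNIV (fourier_transform \<mu>)"
    by (rule lipschitz_onI) (use fourier_transform_lipschitz in \<open>auto simp: dist_norm mult_ac\<close>)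
  then show ?thesis by (rule lipschitz_on_continuous_on)
qed

lemma measurable_fourier_transform [measurable]: "fourier_transform \<mu> \<in> borel_measurable borel"
  by (rule borel_measurable_continuous_onI[OF continuous_fourier_transform])

text \<open>
  The sampling identity for characters, integrated against the measure. A finite partial sum has an
  error of at most the tail of the absolutely convergent series of the kernel, uniformly in \<open>x\<close>, so summation and
  integration may be exchanged. The shift \<open>t\<close> comes for free: it amounts to replacing the measure
  by its product with a character.
\<close>

lemma fourier_transform_sampling:
  fixes K :: "real ^ 'n \<Rightarrow> complex"
  assumes summ: "(\<lambda>j. norm (K (z - lattice_pt j))) summable_on UNIV"
    and rep: "\<And>x. \<forall>i. \<delta> \<le> x $ i \<and> x $ i \<le> 1 - \<delta> \<Longrightarrow>
       ((\<lambda>j. K (z - lattice_pt j) * e_char (- (lattice_pt j \<bullet> x))) has_sum e_char (- (z \<bullet> x))) UNIV"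
  shows "((\<lambda>j. K (z - lattice_pt j) * fourier_transform \<mu> (lattice_pt j + t)) has_sum fourier_transform \<mu> (z + t)) UNIV"
proof -
  let ?k = "\<lambda>j. K (z - lattice_pt j)"
  define A where "A = infsum (\<lambda>j. norm (?k j)) UNIV"
  have hA: "((\<lambda>j. norm (?k j)) has_sum A) UNIV" unfolding A_def using summ by (rule has_sum_infsum)
  have tail: "norm (e_char (- (z \<bullet> x)) - (\<Sum>j\<in>F. ?k j * e_char (- (lattice_pt j \<bullet> x)))) \<le> A - (\<Sum>j\<in>F. norm (?k j))"
    if x: "\<forall>i. \<delta> \<le> x $ i \<and> x $ i \<le> 1 - \<delta>" and F: "finite F" for x F
  proof -
    let ?g = "\<lambda>j. ?k j * e_char (- (lattice_pt j \<bullet> x))"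
    have 1: "(?g has_sum (e_char (- (z \<bullet> x)) - sum ?g F)) (UNIV - F)"
      by (rule has_sum_Diff[OF rep[OF x] has_sum_finite[OF F]]) auto
    have 2: "((\<lambda>j. norm (?g j)) has_sum (A - (\<Sum>j\<in>F. norm (?k j)))) (UNIV - F)"
      using has_sum_Diff[OF hA has_sum_finite[OF F]] by (simp add: norm_mult)
    show ?thesis
      using norm_infsum_bound[OF has_sum_imp_summable[OF 2]] unfolding infsumI[OF 1] infsumI[OF 2] .
  qed
  have bound: "norm (fourier_transform \<mu> (z + t) - (\<Sum>j\<in>F. ?k j * fourier_transform \<mu> (lattice_pt j + t)))
      \<le> (A - (\<Sum>j\<in>F. norm (?k j))) * measure \<mu> (space \<mu>)" if F: "finite F" for F
  proof -
    have le: "(\<Sum>j\<in>F. norm (?k j)) \<le> A"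
      by (rule finite_sum_le_has_sum[OF hA]) (use F in auto)
    have "fourier_transform \<mu> (z + t) - (\<Sum>j\<in>F. ?k j * fourier_transform \<mu> (lattice_pt j + t)) =
       (LINT x|\<mu>. e_char (- ((z + t) \<bullet> x)) - (\<Sum>j\<in>F. ?k j * e_char (- ((lattice_pt j + t) \<bullet> x))))"
      by (simp add: fourier_transform_e_char integrable_character)
    also have "(\<lambda>x. e_char (- ((z + t) \<bullet> x)) - (\<Sum>j\<in>F. ?k j * e_char (- ((lattice_pt j + t) \<bullet> x)))) =
       (\<lambda>x. e_char (- (t \<bullet> x)) * (e_char (- (z \<bullet> x)) - (\<Sum>j\<in>F. ?k j * e_char (- (lattice_pt j \<bullet> x)))))"
    proof
      fix x
      have "e_char (- ((w + t) \<bullet> x)) = e_char (- (t \<bullet> x)) * e_char (- (w \<bullet> x))" for w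
        by (simp flip: e_char_add add: inner_add_left algebra_simps)
      then show "e_char (- ((z + t) \<bullet> x)) - (\<Sum>j\<in>F. ?k j * e_char (- ((lattice_pt j + t) \<bullet> x))) =
         e_char (- (t \<bullet> x)) * (e_char (- (z \<bullet> x)) - (\<Sum>j\<in>F. ?k j * e_char (- (lattice_pt j \<bullet> x))))"
        by (simp add: right_diff_distrib sum_distrib_left mult_ac)
    qed
    also have "norm (LINT x|\<mu>. e_char (- (t \<bullet> x)) * (e_char (- (z \<bullet> x)) - (\<Sum>j\<in>F. ?k j * e_char (- (lattice_pt j \<bullet> x)))))
      \<le> (A - (\<Sum>j\<in>F. norm (?k j))) * measure \<mu> (space \<mu>)"
    proof (rule integral_norm_bound_AE[OF cube_measure_finite])
      show "AE x in \<mu>. norm (e_char (- (t \<bullet> x)) * (e_char (- (z \<bullet> x)) - (\<Sum>j\<in>F. ?k j * e_char (- (lattice_pt j \<bullet> x)))))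
          \<le> A - (\<Sum>j\<in>F. norm (?k j))"
        using cube_measure_AE by (rule AE_mp) (auto simp: norm_mult intro!: AE_I2 tail F)
    qed (use le in simp)
    finally show ?thesis .
  qed
  have lim: "((\<lambda>F. (A - (\<Sum>j\<in>F. norm (?k j))) * measure \<mu> (space \<mu>)) \<longlongrightarrow> (A - A) * measure \<mu> (space \<mu>)) (finite_subsets_at_top UNIV)"
    by (intro tendsto_mult tendsto_diff tendsto_const hA[unfolded has_sum_def])
  have "((\<lambda>F. fourier_transform \<mu> (z + t) - (\<Sum>j\<in>F. ?k j * fourier_transform \<mu> (lattice_pt j + t))) \<longlongrightarrow> 0) (finite_subsets_at_top UNIV)"
  proof (rule Lim_null_comparison)
    show "\<forall>\<^sub>F F in finite_subsets_at_top UNIV. norm (fourier_transform \<mu> (z + t) - (\<Sum>j\<in>F. ?k j * fourier_transform \<mu> (lattice_pt j + t)))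
      \<le> (A - (\<Sum>j\<in>F. norm (?k j))) * measure \<mu> (space \<mu>)"
      by (rule eventually_finite_subsets_at_top_weakI) (rule bound)
  qed (use lim in simp)
  from tendsto_diff[OF tendsto_const this, of "fourier_transform \<mu> (z + t)"]
  show ?thesis by (simp add: has_sum_def)
qed

end

section \<open>Comparison of shifted lattices\<close>

text \<open>
  Sums of extended nonnegative reals are treated as integrals over the counting measure, for which
  monotone convergence and Tonelli's theorem are available.
\<close>

lemma nn_integral_count_space_eq_infsum:
  fixes f :: "'a::countable \<Rightarrow> ennreal"
  shows "(\<integral>\<^sup>+x. f x \<partial>count_space A) = infsum f A"
proof (rule antisym)
  have sup: "infsum f A = (SUP F\<in>{F. finite F \<and> F \<subseteq> A}. sum f F)"
    by (rule nonneg_infsum_complete) simp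
  show "(\<integral>\<^sup>+x. f x \<partial>count_space A) \<le> infsum f A"
  proof (cases "finite A")
    case True
    then show ?thesis by (simp add: nn_integral_count_space_finite)
  next
    case False
    let ?e = "from_nat_into A"
    have e: "bij_betw ?e UNIV A" using False by (intro bij_betw_from_nat_into) auto
    have "(\<integral>\<^sup>+x. f x \<partial>count_space A) = (\<Sum>n. f (?e n))"
      by (simp add: nn_integral_bij_count_space[OF e, symmetric] nn_integral_count_space_nat)
    also have "\<dots> = (SUP n. \<Sum>i<n. f (?e i))" by (rule suminf_eq_SUP)
    also have "\<dots> \<le> infsum f A"
    proof (rule SUP_least)
      fix n
      have inj: "inj_on ?e {..<n}" using e by (meson bij_betw_def inj_on_subset subset_UNIV)
      have "(\<Sum>i<n. f (?e i)) = sum f (?e ` {..<n})" by (simp add: sum.reindex[OF inj])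
      also have "\<dots> \<le> infsum f A"
        unfolding sup by (rule SUP_upper) (use e in \<open>auto simp: bij_betw_def\<close>)
      finally show "(\<Sum>i<n. f (?e i)) \<le> infsum f A" .
    qed
    finally show ?thesis .
  qed
  show "infsum f A \<le> (\<integral>\<^sup>+x. f x \<partial>count_space A)"
    unfolding sup
  proof (rule SUP_least)
    fix F assume F: "F \<in> {F. finite F \<and> F \<subseteq> A}"
    then have "sum f F = (\<integral>\<^sup>+x. f x \<partial>count_space F)" by (simp add: nn_integral_count_space_finite)
    also have "\<dots> = (\<integral>\<^sup>+x. f x * indicator F x \<partial>count_space UNIV)" by (simp add: nn_integral_count_space_indicator)
    also have "\<dots> \<le> (\<integral>\<^sup>+x. f x * indicator A x \<partial>count_space UNIV)"
      using F by (intro nn_integral_mono) (auto split: split_indicator)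
    also have "\<dots> = (\<integral>\<^sup>+x. f x \<partial>count_space A)" by (simp add: nn_integral_count_space_indicator)
    finally show "sum f F \<le> (\<integral>\<^sup>+x. f x \<partial>count_space A)" .
  qed
qed

lemma nn_integral_count_space_summable:
  fixes f :: "'a::countable \<Rightarrow> real"
  assumes "f summable_on A" "\<And>x. 0 \<le> f x"
  shows "(\<integral>\<^sup>+x. ennreal (f x) \<partial>count_space A) = ennreal (infsum f A)"
proof -
  have "(\<integral>\<^sup>+x. ennreal (f x) \<partial>count_space A) = (SUP F\<in>{F. finite F \<and> F \<subseteq> A}. \<Sum>x\<in>F. ennreal (f x))"
    unfolding nn_integral_count_space_eq_infsum by (rule nonneg_infsum_complete) simp
  also have "\<dots> = ennreal (infsum f A)"
    using assms by (subst infsum_nonneg_is_SUPREMUM_ennreal) (auto simp: sum_ennreal)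
  finally show ?thesis .
qed

lemma sum_le_nn_integral_count_space:
  assumes "finite F"
  shows "sum f F \<le> (\<integral>\<^sup>+x. f x \<partial>count_space (UNIV :: 'a::countable set))"
  unfolding nn_integral_count_space_eq_infsum
  by (subst nonneg_infsum_complete) (use assms in \<open>auto intro!: SUP_upper\<close>)

text \<open>
  Half-open, so that its integer translates tile the space without overlap.
\<close>

definition unit_cube :: "(real ^ 'n) set" where
  "unit_cube = {t. \<forall>i. 0 \<le> t $ i \<and> t $ i < 1}"

lemma bracket_le_card:
  assumes "\<And>i. \<bar>t $ i\<bar> \<le> 1"
  shows "bracket (t :: real ^ 'n) \<le> 1 + real CARD('n)"
proof -
  have "norm t \<le> (\<Sum>i\<in>UNIV. \<bar>t $ i\<bar>)" by (rule norm_le_l1_cart)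
  also have "\<dots> \<le> (\<Sum>i\<in>(UNIV::'n set). 1)" by (rule sum_mono) (rule assms)
  finally show ?thesis by (simp add: bracket_def)
qed

text \<open>
  Both points \<open>lattice_pt k + t'\<close> and \<open>lattice_pt j + t\<close> lie within bounded distance of their
  lattice points, so the sampling kernel between them is controlled by \<open>prod_decay\<close> and
  \<open>bracket\<close> at \<open>lattice_pt (k - j)\<close>. Jensen's inequality passes the \<open>p\<close>-th power through the sampling
  series, and Peetre's inequality exchanges the weight at \<open>k\<close> for the weight at \<open>j\<close>.
\<close>

lemma lattice_value_bound:
  fixes \<delta> \<alpha> p :: real
  assumes \<delta>: "0 < \<delta>" "\<delta> < 1/2" and p: "1 < p"
  obtains C :: real where "0 \<le> C"
    "\<And>\<mu> :: (real ^ 'n) measure. \<And>k t t'. cube_measure \<delta> \<mu> \<Longrightarrow> t \<in> unit_cube \<Longrightarrow> t' \<in> unit_cube \<Longrightarrow>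
       ennreal (bracket (lattice_pt k :: real ^ 'n) powr \<alpha> * norm (fourier_transform \<mu> (lattice_pt k + t')) powr p)
         \<le> (\<integral>\<^sup>+j. ennreal (C * prod_decay (lattice_pt (k - j) :: real ^ 'n) *
               (bracket (lattice_pt j :: real ^ 'n) powr \<alpha> * norm (fourier_transform \<mu> (lattice_pt j + t)) powr p)) \<partial>count_space UNIV)"
proof -
  \<comment> \<open>Decay of this order compensates the factor that Peetre's inequality produces.\<close>
  define m where "m = nat \<lceil>\<bar>\<alpha>\<bar>\<rceil>"
  have m: "\<bar>\<alpha>\<bar> \<le> real m" by (simp add: m_def)
  obtain K :: "real ^ 'n \<Rightarrow> complex" and C1 where C1: "0 \<le> C1"
    and K: "\<And>v. norm (K v) \<le> C1 * prod_decay v * bracket v powr (- real m)"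
    and rep: "\<And>z x. \<forall>i. \<delta> \<le> x $ i \<and> x $ i \<le> 1 - \<delta> \<Longrightarrow>
       ((\<lambda>j. K (z - lattice_pt j) * e_char (- (lattice_pt j \<bullet> x))) has_sum e_char (- (z \<bullet> x))) UNIV"
    by (rule sampling_kernel[OF \<delta>, of m]) (rule that)
  let ?d = "real CARD('n)"
  let ?b = "\<lambda>j. prod_decay (lattice_pt j :: real ^ 'n)"
  let ?br = "\<lambda>j. bracket (lattice_pt j :: real ^ 'n)"
  define C2 where "C2 = C1 * 4 ^ CARD('n) * (1 + ?d) powr real m"
  define B where "B = infsum ?b UNIV"
  have C2: "0 \<le> C2" using C1 by (simp add: C2_def)
  have B: "0 \<le> B" unfolding B_def by (rule infsum_nonneg) simp
  have Kbound: "norm (K (lattice_pt i + w)) \<le> C2 * ?b i * ?br i powr (- real m)" if w: "\<And>i. \<bar>w $ i\<bar> \<le> 1" for i w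
  proof -
    have "norm (K (lattice_pt i + w)) \<le> C1 * prod_decay (lattice_pt i + w) * bracket (lattice_pt i + w) powr (- real m)"
      by (rule K)
    also have "\<dots> \<le> C1 * (4 ^ CARD('n) * ?b i) * (?br i powr (- real m) * bracket w powr \<bar>- real m\<bar>)"
      using C1 by (intro mult_mono mult_left_mono prod_decay_translate w peetre_inequality) auto
    also have "\<dots> \<le> C1 * (4 ^ CARD('n) * ?b i) * (?br i powr (- real m) * (1 + ?d) powr \<bar>- real m\<bar>)"
      using C1 by (intro mult_left_mono powr_mono2 bracket_le_card w) auto
    finally show ?thesis by (simp add: C2_def mult_ac)
  qed
  have Kbound1: "norm (K (lattice_pt i + w)) \<le> C2 * ?b i" if w: "\<And>i. \<bar>w $ i\<bar> \<le> 1" for i w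
  proof -
    have "C2 * ?b i * ?br i powr (- real m) \<le> C2 * ?b i * 1"
      using C2 by (intro mult_left_mono bracket_powr_le_1) auto
    then show ?thesis using Kbound[OF w, of i] by simp
  qed
  have Kbound2: "?br k powr \<alpha> * norm (K (lattice_pt (k - j) + w)) \<le> C2 * ?b (k - j) * ?br j powr \<alpha>"
    if w: "\<And>i. \<bar>w $ i\<bar> \<le> 1" for j k w
  proof -
    have "lattice_pt k = lattice_pt j + (lattice_pt (k - j) :: real ^ 'n)" by (simp add: vec_eq_iff)
    then have "?br k powr \<alpha> \<le> ?br j powr \<alpha> * ?br (k - j) powr \<bar>\<alpha>\<bar>"
      by (metis peetre_inequality)
    also have "\<dots> \<le> ?br j powr \<alpha> * ?br (k - j) powr real m"
      by (intro mult_left_mono powr_mono m bracket_ge_1) auto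
    finally have "?br k powr \<alpha> * norm (K (lattice_pt (k - j) + w)) \<le>
        (?br j powr \<alpha> * ?br (k - j) powr real m) * (C2 * ?b (k - j) * ?br (k - j) powr (- real m))"
      by (intro mult_mono Kbound w) auto
    also have "\<dots> = C2 * ?b (k - j) * ?br j powr \<alpha> * (?br (k - j) powr real m * ?br (k - j) powr (- real m))"
      by (simp add: mult_ac)
    also have "?br (k - j) powr real m * ?br (k - j) powr (- real m) = 1"
      by (simp flip: powr_add add: less_imp_neq[OF bracket_pos, symmetric])
    finally show ?thesis by (simp only: mult_1_right)
  qed
  define C where "C = (C2 * B) powr (p - 1) * C2"
  show thesis
  proof
    show "0 \<le> C" using C2 by (simp add: C_def)
    fix \<mu> :: "(real ^ 'n) measure" and k :: "'n \<Rightarrow> int" and t t' :: "real ^ 'n"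
    assume \<mu>: "cube_measure \<delta> \<mu>" and t: "t \<in> unit_cube" and t': "t' \<in> unit_cube"
    let ?f = "fourier_transform \<mu>"
    define w where "w = t' - t"
    have w: "\<bar>w $ i\<bar> \<le> 1" for i
    proof -
      have "0 \<le> t $ i" "t $ i < 1" "0 \<le> t' $ i" "t' $ i < 1" using t t' by (auto simp: unit_cube_def)
      then show ?thesis by (simp add: w_def abs_le_iff)
    qed
    define k' where "k' j = K (lattice_pt (k - j) + w)" for j
    have k': "K (lattice_pt k + w - lattice_pt j) = k' j" for j
      by (simp add: k'_def lattice_pt_diff[symmetric] algebra_simps)
    have k'_summable: "(\<lambda>j. norm (k' j)) summable_on UNIV"
      by (rule summable_on_comparison_test[OF summable_on_cmult_right[OF prod_decay_summable_reflect(1)]])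
         (use Kbound1[OF w] in \<open>auto simp: k'_def\<close>)
    have "((\<lambda>j. k' j * ?f (lattice_pt j + t)) has_sum ?f (lattice_pt k + w + t)) UNIV"
      unfolding k'[symmetric]
      by (rule fourier_transform_sampling[OF \<mu> \<delta>], unfold k', rule k'_summable, fold k', rule rep)
    then have lim: "((\<lambda>F. \<Sum>j\<in>F. k' j * ?f (lattice_pt j + t)) \<longlongrightarrow> ?f (lattice_pt k + t')) (finite_subsets_at_top UNIV)"
      by (simp add: has_sum_def w_def)
    let ?g = "\<lambda>j. ?br j powr \<alpha> * norm (?f (lattice_pt j + t)) powr p"
    have fin: "?br k powr \<alpha> * norm (\<Sum>j\<in>F. k' j * ?f (lattice_pt j + t)) powr p \<le> (\<Sum>j\<in>F. C * ?b (k - j) * ?g j)"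
      if F: "finite F" for F
    proof -
      have "(\<Sum>j\<in>F. norm (k' j)) \<le> (\<Sum>j\<in>F. C2 * ?b (k - j))"
        unfolding k'_def by (intro sum_mono Kbound1 w)
      also have "\<dots> = C2 * (\<Sum>j\<in>F. ?b (k - j))" by (simp add: sum_distrib_left)
      also have "\<dots> \<le> C2 * B"
        unfolding B_def prod_decay_summable_reflect(2)[of k, symmetric]
        by (intro mult_left_mono C2 finite_sum_le_infsum prod_decay_summable_reflect(1) F) auto
      finally have sumk: "(\<Sum>j\<in>F. norm (k' j)) \<le> C2 * B" .
      have "norm (\<Sum>j\<in>F. k' j * ?f (lattice_pt j + t)) \<le> (\<Sum>j\<in>F. norm (k' j) * norm (?f (lattice_pt j + t)))"
        by (rule order_trans[OF norm_sum]) (simp add: norm_mult)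
      then have "norm (\<Sum>j\<in>F. k' j * ?f (lattice_pt j + t)) powr p \<le> (\<Sum>j\<in>F. norm (k' j) * norm (?f (lattice_pt j + t))) powr p"
        using p by (intro powr_mono2) auto
      also have "\<dots> \<le> (\<Sum>j\<in>F. norm (k' j)) powr (p - 1) * (\<Sum>j\<in>F. norm (k' j) * norm (?f (lattice_pt j + t)) powr p)"
        by (rule weighted_power_mean[OF p]) auto
      also have "\<dots> \<le> (C2 * B) powr (p - 1) * (\<Sum>j\<in>F. norm (k' j) * norm (?f (lattice_pt j + t)) powr p)"
        using p by (intro mult_right_mono powr_mono2 sumk) (auto intro!: sum_nonneg)
      finally have "?br k powr \<alpha> * norm (\<Sum>j\<in>F. k' j * ?f (lattice_pt j + t)) powr p \<le>
        ?br k powr \<alpha> * ((C2 * B) powr (p - 1) * (\<Sum>j\<in>F. norm (k' j) * norm (?f (lattice_pt j + t)) powr p))"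
        by (intro mult_left_mono) auto
      also have "\<dots> = (C2 * B) powr (p - 1) * (\<Sum>j\<in>F. (?br k powr \<alpha> * norm (k' j)) * norm (?f (lattice_pt j + t)) powr p)"
        by (simp add: sum_distrib_left mult_ac)
      also have "\<dots> \<le> (C2 * B) powr (p - 1) * (\<Sum>j\<in>F. (C2 * ?b (k - j) * ?br j powr \<alpha>) * norm (?f (lattice_pt j + t)) powr p)"
        unfolding k'_def by (intro mult_left_mono sum_mono mult_right_mono Kbound2 w) auto
      also have "\<dots> = (\<Sum>j\<in>F. C * ?b (k - j) * ?g j)"
        by (simp add: C_def sum_distrib_left mult_ac)
      finally show ?thesis .
    qed
    have "((\<lambda>F. ennreal (?br k powr \<alpha> * norm (\<Sum>j\<in>F. k' j * ?f (lattice_pt j + t)) powr p))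
        \<longlongrightarrow> ennreal (?br k powr \<alpha> * norm (?f (lattice_pt k + t')) powr p)) (finite_subsets_at_top UNIV)"
      using p by (intro tendsto_ennrealI tendsto_mult tendsto_const tendsto_powr' tendsto_norm lim) auto
    moreover have "\<forall>\<^sub>F F in finite_subsets_at_top UNIV. ennreal (?br k powr \<alpha> * norm (\<Sum>j\<in>F. k' j * ?f (lattice_pt j + t)) powr p)
       \<le> (\<integral>\<^sup>+j. ennreal (C * ?b (k - j) * ?g j) \<partial>count_space UNIV)"
    proof (rule eventually_finite_subsets_at_top_weakI)
      fix F :: "('n \<Rightarrow> int) set" assume F: "finite F"
      have "ennreal (?br k powr \<alpha> * norm (\<Sum>j\<in>F. k' j * ?f (lattice_pt j + t)) powr p) \<le> ennreal (\<Sum>j\<in>F. C * ?b (k - j) * ?g j)"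
        by (intro ennreal_leI fin F)
      also have "\<dots> = (\<Sum>j\<in>F. ennreal (C * ?b (k - j) * ?g j))"
        using \<open>0 \<le> C\<close> by (subst sum_ennreal) auto
      also have "\<dots> \<le> (\<integral>\<^sup>+j. ennreal (C * ?b (k - j) * ?g j) \<partial>count_space UNIV)"
        by (rule sum_le_nn_integral_count_space[OF F])
      finally show "ennreal (?br k powr \<alpha> * norm (\<Sum>j\<in>F. k' j * ?f (lattice_pt j + t)) powr p)
        \<le> (\<integral>\<^sup>+j. ennreal (C * ?b (k - j) * ?g j) \<partial>count_space UNIV)" .
    qed
    ultimately show "ennreal (?br k powr \<alpha> * norm (?f (lattice_pt k + t')) powr p)
        \<le> (\<integral>\<^sup>+j. ennreal (C * ?b (k - j) * ?g j) \<partial>count_space UNIV)"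
      by (rule tendsto_upperbound) auto
  qed
qed

text \<open>
  The weighted power sum of the transform over the lattice shifted by \<open>t\<close>, with the weight taken
  at the unshifted lattice point.
\<close>

definition lattice_block :: "real \<Rightarrow> real \<Rightarrow> (real ^ 'n) measure \<Rightarrow> real ^ 'n \<Rightarrow> ennreal" where
  "lattice_block \<alpha> p \<mu> t = (\<integral>\<^sup>+j. ennreal (bracket (lattice_pt j :: real ^ 'n) powr \<alpha> *
     norm (fourier_transform \<mu> (lattice_pt j + t)) powr p) \<partial>count_space UNIV)"

text \<open>
  Schur's test: summing the pointwise bound over \<open>k\<close> first leaves the sum of \<open>prod_decay\<close> over
  the lattice, which is finite and independent of \<open>j\<close>. Since \<open>t\<close> and \<open>t'\<close> may be interchanged,
  all shifted lattices carry comparable sums, and this one estimate serves both directions of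
  the comparison between sums and integrals.
\<close>

lemma lattice_block_comparable:
  fixes \<delta> \<alpha> p :: real
  assumes \<delta>: "0 < \<delta>" "\<delta> < 1/2" and p: "1 < p"
  obtains C :: real where "0 \<le> C"
    "\<And>\<mu> :: (real ^ 'n) measure. \<And>t t'. cube_measure \<delta> \<mu> \<Longrightarrow> t \<in> unit_cube \<Longrightarrow> t' \<in> unit_cube \<Longrightarrow>
       lattice_block \<alpha> p \<mu> t' \<le> ennreal C * lattice_block \<alpha> p \<mu> t"
proof -
  let ?b = "\<lambda>j. prod_decay (lattice_pt j :: real ^ 'n)"
  obtain C :: real where C: "0 \<le> C" and bound:
    "\<And>\<mu> :: (real ^ 'n) measure. \<And>k t t'. cube_measure \<delta> \<mu> \<Longrightarrow> t \<in> unit_cube \<Longrightarrow> t' \<in> unit_cube \<Longrightarrow>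
       ennreal (bracket (lattice_pt k :: real ^ 'n) powr \<alpha> * norm (fourier_transform \<mu> (lattice_pt k + t')) powr p)
         \<le> (\<integral>\<^sup>+j. ennreal (C * ?b (k - j) *
               (bracket (lattice_pt j :: real ^ 'n) powr \<alpha> * norm (fourier_transform \<mu> (lattice_pt j + t)) powr p)) \<partial>count_space UNIV)"
    by (rule lattice_value_bound[OF \<delta> p, of \<alpha>]) (rule that)
  define B where "B = infsum ?b UNIV"
  have B: "0 \<le> B" unfolding B_def by (rule infsum_nonneg) simp
  show thesis
  proof
    show "0 \<le> C * B" using C B by simp
    fix \<mu> :: "(real ^ 'n) measure" and t t' :: "real ^ 'n"
    assume \<mu>: "cube_measure \<delta> \<mu>" and t: "t \<in> unit_cube" and t': "t' \<in> unit_cube"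
    define g where "g j = bracket (lattice_pt j :: real ^ 'n) powr \<alpha> * norm (fourier_transform \<mu> (lattice_pt j + t)) powr p" for j
    have g: "0 \<le> g j" for j by (simp add: g_def)
    have "lattice_block \<alpha> p \<mu> t' \<le> (\<integral>\<^sup>+k. (\<integral>\<^sup>+j. ennreal (C * ?b (k - j) * g j) \<partial>count_space UNIV) \<partial>count_space UNIV)"
      unfolding lattice_block_def g_def by (intro nn_integral_mono bound \<mu> t t')
    also have "\<dots> = (\<integral>\<^sup>+j. (\<integral>\<^sup>+k. ennreal (C * ?b (k - j) * g j) \<partial>count_space UNIV) \<partial>count_space UNIV)"
      by (rule nn_integral_count_space_nn_integral) auto
    also have "\<dots> = (\<integral>\<^sup>+j. ennreal (C * B) * ennreal (g j) \<partial>count_space UNIV)"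
    proof (rule nn_integral_cong)
      fix j :: "'n \<Rightarrow> int"
      have bij: "bij (\<lambda>k. k - j)"
        by (rule bij_betw_byWitness[where f' = "\<lambda>k i. k i + j i"]) (auto simp: fun_eq_iff)
      have "(\<integral>\<^sup>+k. ennreal (C * ?b (k - j) * g j) \<partial>count_space UNIV)
          = (\<integral>\<^sup>+k. ennreal (C * g j) * ennreal (?b (k - j)) \<partial>count_space UNIV)"
        using C g by (intro nn_integral_cong) (simp add: ennreal_mult[symmetric] mult_ac)
      also have "\<dots> = ennreal (C * g j) * (\<integral>\<^sup>+k. ennreal (?b (k - j)) \<partial>count_space UNIV)"
        by (rule nn_integral_cmult) simp
      also have "(\<integral>\<^sup>+k. ennreal (?b (k - j)) \<partial>count_space UNIV) = ennreal B"
        unfolding nn_integral_bij_count_space[OF bij, of "\<lambda>k. ennreal (?b k)"] B_def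
        by (rule nn_integral_count_space_summable[OF prod_decay_summable]) simp
      also have "ennreal (C * g j) * ennreal B = ennreal (C * B) * ennreal (g j)"
        using C B g by (simp add: ennreal_mult[symmetric] mult_ac)
      finally show "(\<integral>\<^sup>+k. ennreal (C * ?b (k - j) * g j) \<partial>count_space UNIV) = ennreal (C * B) * ennreal (g j)" .
    qed
    also have "\<dots> = ennreal (C * B) * lattice_block \<alpha> p \<mu> t"
      unfolding lattice_block_def g_def by (rule nn_integral_cmult) simp
    finally show "lattice_block \<alpha> p \<mu> t' \<le> ennreal (C * B) * lattice_block \<alpha> p \<mu> t" .
  qed
qed

section \<open>Tiling the space by unit cubes\<close>

lemma lattice_pt_floor_unique:
  "z - lattice_pt j \<in> unit_cube \<longleftrightarrow> j = (\<lambda>i. \<lfloor>z $ i\<rfloor>)"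
proof
  assume z: "z - lattice_pt j \<in> unit_cube"
  show "j = (\<lambda>i. \<lfloor>z $ i\<rfloor>)"
  proof
    fix i
    have "0 \<le> (z - lattice_pt j) $ i \<and> (z - lattice_pt j) $ i < 1" using z by (simp add: unit_cube_def)
    then have "\<lfloor>z $ i\<rfloor> = j i" by (intro floor_unique) auto
    then show "j i = \<lfloor>z $ i\<rfloor>" by simp
  qed
next
  assume "j = (\<lambda>i. \<lfloor>z $ i\<rfloor>)"
  then show "z - lattice_pt j \<in> unit_cube"
    by (auto simp: unit_cube_def) linarith
qed

lemma unit_cube_sandwich: "box 0 One \<subseteq> (unit_cube :: (real ^ 'n) set)" "(unit_cube :: (real ^ 'n) set) \<subseteq> cbox 0 One"
proof -
  have "(One :: real ^ 'n) $ i = 1" for i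
    using inner_sum_left_Basis[of "axis i (1::real) :: real ^ 'n" "\<lambda>_. 1"] by (simp add: inner_axis axis_in_Basis_iff)
  then show "box 0 One \<subseteq> (unit_cube :: (real ^ 'n) set)" "(unit_cube :: (real ^ 'n) set) \<subseteq> cbox 0 One"
    by (auto simp: unit_cube_def mem_box_cart less_imp_le)
qed

lemma sets_unit_cube [measurable]: "(unit_cube :: (real ^ 'n) set) \<in> sets borel"
proof -
  have "unit_cube = {t :: real ^ 'n \<in> space borel. \<forall>i. 0 \<le> t $ i \<and> t $ i < 1}" by (simp add: unit_cube_def)
  also have "\<dots> \<in> sets borel" by measurable
  finally show ?thesis .
qed

lemma emeasure_unit_cube: "emeasure lborel (unit_cube :: (real ^ 'n) set) = 1"
proof (rule antisym)
  have "emeasure lborel (unit_cube :: (real ^ 'n) set) \<le> emeasure lborel (cbox 0 (One :: real ^ 'n))"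
    by (rule emeasure_mono[OF unit_cube_sandwich(2)]) simp
  also have "\<dots> = 1" by (subst emeasure_lborel_cbox) auto
  finally show "emeasure lborel (unit_cube :: (real ^ 'n) set) \<le> 1" .
  have "1 = emeasure lborel (box 0 (One :: real ^ 'n))" by (subst emeasure_lborel_box) auto
  also have "\<dots> \<le> emeasure lborel (unit_cube :: (real ^ 'n) set)"
    by (rule emeasure_mono[OF unit_cube_sandwich(1)]) simp
  finally show "1 \<le> emeasure lborel (unit_cube :: (real ^ 'n) set)" .
qed

lemma zero_in_unit_cube: "0 \<in> unit_cube" by (simp add: unit_cube_def)

text \<open>
  Every point lies in exactly one translate of the unit cube, the one given by the integer parts of
  its coordinates; translation invariance moves each tile back to the unit cube.
\<close>

lemma nn_integral_lborel_tiling: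
  fixes g :: "real ^ 'n \<Rightarrow> ennreal"
  assumes g [measurable]: "g \<in> borel_measurable borel"
  shows "(\<integral>\<^sup>+z. g z \<partial>lborel) =
    (\<integral>\<^sup>+t. (\<integral>\<^sup>+j. g (lattice_pt j + t) \<partial>count_space UNIV) * indicator unit_cube t \<partial>lborel)"
proof -
  let ?Q = "unit_cube :: (real ^ 'n) set"
  have "(\<integral>\<^sup>+z. g z \<partial>lborel) = (\<integral>\<^sup>+z. (\<integral>\<^sup>+j. g z * indicator ?Q (z - lattice_pt j) \<partial>count_space UNIV) \<partial>lborel)"
  proof (rule nn_integral_cong)
    fix z :: "real ^ 'n"
    have "(\<integral>\<^sup>+j. g z * indicator ?Q (z - lattice_pt j) \<partial>count_space UNIV)
        = (\<integral>\<^sup>+j. g z * indicator {\<lambda>i. \<lfloor>z $ i\<rfloor>} j \<partial>count_space UNIV)"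
      by (intro nn_integral_cong) (simp add: indicator_def lattice_pt_floor_unique)
    also have "\<dots> = g z" by (subst nn_integral_cmult_indicator) auto
    finally show "g z = (\<integral>\<^sup>+j. g z * indicator ?Q (z - lattice_pt j) \<partial>count_space UNIV)" by simp
  qed
  also have "\<dots> = (\<integral>\<^sup>+j. (\<integral>\<^sup>+z. g z * indicator ?Q (z - lattice_pt j) \<partial>lborel) \<partial>count_space UNIV)"
    by (rule nn_integral_count_space_nn_integral) auto
  also have "\<dots> = (\<integral>\<^sup>+j. (\<integral>\<^sup>+t. g (lattice_pt j + t) * indicator ?Q t \<partial>lborel) \<partial>count_space UNIV)"
  proof (rule nn_integral_cong)
    fix j :: "'n \<Rightarrow> int"
    have "(\<integral>\<^sup>+z. g z * indicator ?Q (z - lattice_pt j) \<partial>lborel)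
        = (\<integral>\<^sup>+z. g z * indicator ?Q (z - lattice_pt j) \<partial>(distr lborel borel ((+) (lattice_pt j))))"
      by (simp add: lborel_distr_plus)
    also have "\<dots> = (\<integral>\<^sup>+t. g (lattice_pt j + t) * indicator ?Q t \<partial>lborel)"
      by (subst nn_integral_distr) auto
    finally show "(\<integral>\<^sup>+z. g z * indicator ?Q (z - lattice_pt j) \<partial>lborel)
        = (\<integral>\<^sup>+t. g (lattice_pt j + t) * indicator ?Q t \<partial>lborel)" .
  qed
  also have "\<dots> = (\<integral>\<^sup>+t. (\<integral>\<^sup>+j. g (lattice_pt j + t) * indicator ?Q t \<partial>count_space UNIV) \<partial>lborel)"
    by (rule nn_integral_count_space_nn_integral[symmetric]) auto
  also have "\<dots> = (\<integral>\<^sup>+t. (\<integral>\<^sup>+j. g (lattice_pt j + t) \<partial>count_space UNIV) * indicator ?Q t \<partial>lborel)"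
    by (intro nn_integral_cong nn_integral_multc) simp
  finally show ?thesis .
qed

definition bracket_energy :: "real \<Rightarrow> real \<Rightarrow> (real ^ 'n) measure \<Rightarrow> ennreal" where
  "bracket_energy \<alpha> p \<mu> = (\<integral>\<^sup>+z. ennreal (bracket z powr \<alpha> * norm (fourier_transform \<mu> z) powr p) \<partial>lborel)"

text \<open>
  The integral is the average over the unit cube of the sums over shifted lattices, up to the
  bounded ratio between the weights at a point and at its lattice point. All these sums are
  comparable to the one at shift \<open>0\<close>.
\<close>

lemma bracket_energy_lattice_block:
  fixes \<delta> \<alpha> p :: real
  assumes \<delta>: "0 < \<delta>" "\<delta> < 1/2" and p: "1 < p"
  obtains C :: real where "0 \<le> C"
    "\<And>\<mu> :: (real ^ 'n) measure. cube_measure \<delta> \<mu> \<Longrightarrow> bracket_energy \<alpha> p \<mu> \<le> ennreal C * lattice_block \<alpha> p \<mu> 0"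
    "\<And>\<mu> :: (real ^ 'n) measure. cube_measure \<delta> \<mu> \<Longrightarrow> lattice_block \<alpha> p \<mu> 0 \<le> ennreal C * bracket_energy \<alpha> p \<mu>"
proof -
  obtain C :: real where C: "0 \<le> C" and cmp:
    "\<And>\<mu> :: (real ^ 'n) measure. \<And>t t'. cube_measure \<delta> \<mu> \<Longrightarrow> t \<in> unit_cube \<Longrightarrow> t' \<in> unit_cube \<Longrightarrow>
       lattice_block \<alpha> p \<mu> t' \<le> ennreal C * lattice_block \<alpha> p \<mu> t"
    by (rule lattice_block_comparable[OF \<delta> p, of \<alpha>]) (rule that)
  define c where "c = (1 + real CARD('n)) powr \<bar>\<alpha>\<bar>"
  have c: "0 \<le> c" by (simp add: c_def)
  have brt: "bracket t powr \<bar>\<alpha>\<bar> \<le> c" if "t \<in> unit_cube" for t :: "real ^ 'n"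
    unfolding c_def using that by (intro powr_mono2 bracket_le_card) (auto simp: unit_cube_def less_imp_le abs_le_iff intro: order_trans[of _ 0])
  have up: "bracket (lattice_pt j + t) powr \<alpha> \<le> c * bracket (lattice_pt j) powr \<alpha>"
    and low: "bracket (lattice_pt j) powr \<alpha> \<le> c * bracket (lattice_pt j + t) powr \<alpha>"
    if t: "t \<in> unit_cube" for t :: "real ^ 'n" and j
  proof -
    have "bracket (lattice_pt j + t) powr \<alpha> \<le> bracket (lattice_pt j) powr \<alpha> * bracket t powr \<bar>\<alpha>\<bar>"
      by (rule peetre_inequality)
    also have "\<dots> \<le> bracket (lattice_pt j) powr \<alpha> * c"
      by (intro mult_left_mono brt t) auto
    finally show "bracket (lattice_pt j + t) powr \<alpha> \<le> c * bracket (lattice_pt j) powr \<alpha>" by (simp add: mult.commute)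
    have "bracket (lattice_pt j) powr \<alpha> \<le> bracket (lattice_pt j + t) powr \<alpha> * bracket (- t) powr \<bar>\<alpha>\<bar>"
      using peetre_inequality[of "lattice_pt j + t" "- t" \<alpha>] by simp
    also have "\<dots> \<le> bracket (lattice_pt j + t) powr \<alpha> * c"
      using brt[OF t] by (intro mult_left_mono) (auto simp: bracket_def)
    finally show "bracket (lattice_pt j) powr \<alpha> \<le> c * bracket (lattice_pt j + t) powr \<alpha>" by (simp add: mult.commute)
  qed
  show thesis
  proof
    show "0 \<le> c * C" using c C by simp
    fix \<mu> :: "(real ^ 'n) measure" assume \<mu>: "cube_measure \<delta> \<mu>"
    note [measurable] = measurable_fourier_transform[OF \<mu> \<delta>]
    have br_meas [measurable]: "bracket \<in> borel_measurable (borel :: (real ^ 'n) measure)"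
      unfolding bracket_def[abs_def] by measurable
    let ?f = "fourier_transform \<mu>" and ?Q = "unit_cube :: (real ^ 'n) set"
    define h where "h z = ennreal (bracket z powr \<alpha> * norm (?f z) powr p)" for z
    have h [measurable]: "h \<in> borel_measurable borel" unfolding h_def by measurable
    have tile: "bracket_energy \<alpha> p \<mu> = (\<integral>\<^sup>+t. (\<integral>\<^sup>+j. h (lattice_pt j + t) \<partial>count_space UNIV) * indicator ?Q t \<partial>lborel)"
      unfolding bracket_energy_def h_def[symmetric] by (rule nn_integral_lborel_tiling[OF h])
    have const: "(\<integral>\<^sup>+t. ennreal a * b * indicator ?Q t \<partial>lborel) = ennreal a * b" for a b
      using emeasure_unit_cube[where 'n = 'n] by (simp add: nn_integral_cmult_indicator)
    have "bracket_energy \<alpha> p \<mu> \<le> (\<integral>\<^sup>+t. ennreal (c * C) * lattice_block \<alpha> p \<mu> 0 * indicator ?Q t \<partial>lborel)"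
      unfolding tile
    proof (rule nn_integral_mono)
      fix t :: "real ^ 'n"
      show "(\<integral>\<^sup>+j. h (lattice_pt j + t) \<partial>count_space UNIV) * indicator ?Q t \<le> ennreal (c * C) * lattice_block \<alpha> p \<mu> 0 * indicator ?Q t"
      proof (cases "t \<in> ?Q")
        case True
        have "(\<integral>\<^sup>+j. h (lattice_pt j + t) \<partial>count_space UNIV) \<le>
            (\<integral>\<^sup>+j. ennreal c * ennreal (bracket (lattice_pt j :: real ^ 'n) powr \<alpha> * norm (?f (lattice_pt j + t)) powr p) \<partial>count_space UNIV)"
          unfolding h_def
        proof (rule nn_integral_mono)
          fix j :: "'n \<Rightarrow> int"
          have "bracket (lattice_pt j + t) powr \<alpha> * norm (?f (lattice_pt j + t)) powr p \<le>
             c * bracket (lattice_pt j :: real ^ 'n) powr \<alpha> * norm (?f (lattice_pt j + t)) powr p"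
            by (intro mult_right_mono up True) auto
          then show "ennreal (bracket (lattice_pt j + t) powr \<alpha> * norm (?f (lattice_pt j + t)) powr p) \<le>
             ennreal c * ennreal (bracket (lattice_pt j :: real ^ 'n) powr \<alpha> * norm (?f (lattice_pt j + t)) powr p)"
            using c by (simp add: ennreal_mult[symmetric] ennreal_leI mult.assoc)
        qed
        also have "\<dots> = ennreal c * lattice_block \<alpha> p \<mu> t"
          unfolding lattice_block_def by (rule nn_integral_cmult) simp
        also have "\<dots> \<le> ennreal c * (ennreal C * lattice_block \<alpha> p \<mu> 0)"
          by (intro mult_left_mono cmp \<mu> True zero_in_unit_cube) auto
        finally show ?thesis using True c C by (simp add: ennreal_mult mult.assoc)
      qed simp
    qed
    then show "bracket_energy \<alpha> p \<mu> \<le> ennreal (c * C) * lattice_block \<alpha> p \<mu> 0" unfolding const .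
    have "lattice_block \<alpha> p \<mu> 0 = (\<integral>\<^sup>+t. ennreal 1 * lattice_block \<alpha> p \<mu> 0 * indicator ?Q t \<partial>lborel)"
      unfolding const by simp
    also have "\<dots> \<le> (\<integral>\<^sup>+t. (\<integral>\<^sup>+j. ennreal (c * C) * h (lattice_pt j + t) \<partial>count_space UNIV) * indicator ?Q t \<partial>lborel)"
    proof (rule nn_integral_mono)
      fix t :: "real ^ 'n"
      have cm: "(\<integral>\<^sup>+j. ennreal (c * C) * h (lattice_pt j + t) \<partial>count_space UNIV) = ennreal (c * C) * (\<integral>\<^sup>+j. h (lattice_pt j + t) \<partial>count_space UNIV)"
        by (rule nn_integral_cmult) simp
      show "ennreal 1 * lattice_block \<alpha> p \<mu> 0 * indicator ?Q t \<le> (\<integral>\<^sup>+j. ennreal (c * C) * h (lattice_pt j + t) \<partial>count_space UNIV) * indicator ?Q t"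
      proof (cases "t \<in> ?Q")
        case True
        have "lattice_block \<alpha> p \<mu> 0 \<le> ennreal C * lattice_block \<alpha> p \<mu> t"
          by (intro cmp \<mu> True zero_in_unit_cube)
        also have "lattice_block \<alpha> p \<mu> t \<le> (\<integral>\<^sup>+j. ennreal c * h (lattice_pt j + t) \<partial>count_space UNIV)"
          unfolding lattice_block_def h_def
        proof (rule nn_integral_mono)
          fix j :: "'n \<Rightarrow> int"
          have "bracket (lattice_pt j :: real ^ 'n) powr \<alpha> * norm (?f (lattice_pt j + t)) powr p \<le>
             c * bracket (lattice_pt j + t) powr \<alpha> * norm (?f (lattice_pt j + t)) powr p"
            by (intro mult_right_mono low True) auto
          then show "ennreal (bracket (lattice_pt j :: real ^ 'n) powr \<alpha> * norm (?f (lattice_pt j + t)) powr p) \<le>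
             ennreal c * ennreal (bracket (lattice_pt j + t) powr \<alpha> * norm (?f (lattice_pt j + t)) powr p)"
            using c by (simp add: ennreal_mult[symmetric] ennreal_leI mult.assoc)
        qed
        also have "\<dots> = ennreal c * (\<integral>\<^sup>+j. h (lattice_pt j + t) \<partial>count_space UNIV)"
          by (rule nn_integral_cmult) simp
        finally have "lattice_block \<alpha> p \<mu> 0 \<le> ennreal C * (ennreal c * (\<integral>\<^sup>+j. h (lattice_pt j + t) \<partial>count_space UNIV))"
          by (simp add: mult_left_mono)
        then have "lattice_block \<alpha> p \<mu> 0 \<le> ennreal (c * C) * (\<integral>\<^sup>+j. h (lattice_pt j + t) \<partial>count_space UNIV)"
          using c C by (simp only: ennreal_mult mult_ac)
        then show ?thesis using True by (simp only: cm indicator_simps ennreal_1 mult_1_left mult_1_right)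
      qed simp
    qed
    also have "\<dots> = (\<integral>\<^sup>+z. ennreal (c * C) * h z \<partial>lborel)"
      by (rule nn_integral_lborel_tiling[symmetric]) simp
    also have "\<dots> = ennreal (c * C) * bracket_energy \<alpha> p \<mu>"
      unfolding bracket_energy_def h_def[symmetric] by (rule nn_integral_cmult) simp
    finally show "lattice_block \<alpha> p \<mu> 0 \<le> ennreal (c * C) * bracket_energy \<alpha> p \<mu>" .
  qed
qed

section \<open>The weight near the origin\<close>

lemma nn_integral_abs_powr_finite:
  fixes b :: real
  assumes b: "-1 < b"
  shows "(\<integral>\<^sup>+t. ennreal (\<bar>t\<bar> powr b * indicator {-1..1} t) \<partial>lborel) < \<infinity>"
proof -
  define g where "g t = t powr b * indicator {0..1} t" for t :: real
  have g [measurable]: "g \<in> borel_measurable borel" unfolding g_def by measurable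
  have "((\<lambda>t. t powr b) has_integral (1 / (b + 1))) {0..1}"
    using has_integral_powr_from_0[OF b, of 1] by simp
  then have "((\<lambda>t. if t \<in> {0..1} then t powr b else 0) has_integral (1 / (b + 1))) UNIV"
    by (subst has_integral_restrict_UNIV)
  also have "(\<lambda>t. if t \<in> {0..1} then t powr b else 0) = g" by (auto simp: g_def fun_eq_iff)
  finally have int: "(\<integral>\<^sup>+t. ennreal (g t) \<partial>lborel) = ennreal (1 / (b + 1))"
    by (intro nn_integral_has_integral_lborel g) (auto simp: g_def)
  have int': "(\<integral>\<^sup>+t. ennreal (g (- t)) \<partial>lborel) = ennreal (1 / (b + 1))"
    using nn_integral_real_affine[of "\<lambda>t. ennreal (g t)" "-1" 0] int by simp
  have "(\<integral>\<^sup>+t. ennreal (\<bar>t\<bar> powr b * indicator {-1..1} t) \<partial>lborel)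
      \<le> (\<integral>\<^sup>+t. ennreal (g t) + ennreal (g (- t)) \<partial>lborel)"
    by (intro nn_integral_mono)
       (auto simp: g_def abs_if indicator_def simp flip: ennreal_plus intro!: ennreal_leI)
  also have "\<dots> = ennreal (1 / (b + 1)) + ennreal (1 / (b + 1))"
    using int int' by (subst nn_integral_add) auto
  also have "\<dots> < \<infinity>" by (simp add: ennreal_add_eq_top less_top)
  finally show ?thesis .
qed

text \<open>
  In the singular case \<open>\<alpha> < 0\<close> the inequality \<open>norm z \<ge> \<bar>z \<bullet> i\<bar>\<close> bounds \<open>norm z powr \<alpha>\<close> by the
  product of the powers \<open>\<bar>z \<bullet> i\<bar> powr (\<alpha> / DIM('a))\<close>, whose exponents exceed \<open>-1\<close>; Tonelli's theorem
  then reduces the claim to dimension one.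
\<close>

lemma nn_integral_norm_powr_ball_finite:
  fixes \<alpha> :: real
  assumes \<alpha>: "- real DIM('a::euclidean_space) < \<alpha>"
  shows "(\<integral>\<^sup>+z. ennreal (norm z powr \<alpha> * indicator (ball 0 1) z) \<partial>(lborel :: 'a measure)) < \<infinity>"
proof (cases "0 \<le> \<alpha>")
  case True
  have "(\<integral>\<^sup>+z. ennreal (norm z powr \<alpha> * indicator (ball 0 1) z) \<partial>(lborel :: 'a measure))
      \<le> (\<integral>\<^sup>+z. indicator (ball 0 1) z \<partial>(lborel :: 'a measure))"
  proof (rule nn_integral_mono)
    fix z :: 'a
    show "ennreal (norm z powr \<alpha> * indicator (ball 0 1) z) \<le> indicator (ball 0 1) z"
      using powr_mono2[of \<alpha> "norm z" 1] True by (auto simp: indicator_def)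
  qed
  also have "\<dots> = emeasure lborel (ball 0 1 :: 'a set)" by simp
  also have "\<dots> < \<infinity>" by (rule emeasure_lborel_ball_finite)
  finally show ?thesis .
next
  case False
  define b where "b = \<alpha> / real DIM('a)"
  have d: "0 < real DIM('a)" by simp
  have b: "-1 < b" "b < 0"
    unfolding b_def using \<alpha> False d by (simp_all only: pos_less_divide_eq pos_divide_less_eq)
  \<comment> \<open>The value \<open>\<infinity>\<close> at \<open>0\<close> makes the product bound hold on the coordinate hyperplanes as well, where \<open>0 powr b = 0\<close> would break it.\<close>
  define h where "h t = (if t = 0 then \<infinity> else ennreal (\<bar>t\<bar> powr b * indicator {-1..1} t))" for t :: real
  have h [measurable]: "h \<in> borel_measurable borel" unfolding h_def by measurable
  have "(\<integral>\<^sup>+t. h t \<partial>lborel) = (\<integral>\<^sup>+t. ennreal (\<bar>t\<bar> powr b * indicator {-1..1} t) \<partial>lborel)"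
    by (intro nn_integral_cong_AE eventually_mono[OF AE_lborel_singleton[of 0]]) (simp add: h_def)
  then have h_fin: "(\<integral>\<^sup>+t. h t \<partial>lborel) < \<infinity>" using nn_integral_abs_powr_finite[OF b(1)] by simp
  have "(\<integral>\<^sup>+z. ennreal (norm z powr \<alpha> * indicator (ball 0 1) z) \<partial>(lborel :: 'a measure))
      \<le> (\<integral>\<^sup>+z. (\<Prod>i\<in>Basis. h (z \<bullet> i)) \<partial>(lborel :: 'a measure))"
  proof (rule nn_integral_mono)
    fix z :: 'a
    show "ennreal (norm z powr \<alpha> * indicator (ball 0 1) z) \<le> (\<Prod>i\<in>Basis. h (z \<bullet> i))"
    proof (cases "z \<in> ball 0 1 \<and> z \<noteq> 0")
      case True
      have "ennreal (norm z powr \<alpha>) = ennreal ((norm z powr b) ^ DIM('a))"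
        using True by (simp add: b_def powr_realpow[symmetric] powr_powr)
      also have "\<dots> = (\<Prod>i\<in>(Basis :: 'a set). ennreal (norm z powr b))" by (simp add: ennreal_power)
      also have "\<dots> \<le> (\<Prod>i\<in>Basis. h (z \<bullet> i))"
      proof (rule prod_mono_ennreal)
        fix i :: 'a assume i: "i \<in> Basis"
        have le: "\<bar>z \<bullet> i\<bar> \<le> norm z" by (rule Basis_le_norm[OF i])
        show "ennreal (norm z powr b) \<le> h (z \<bullet> i)"
        proof (cases "z \<bullet> i = 0")
          case False
          have "norm z powr b \<le> \<bar>z \<bullet> i\<bar> powr b"
            using le False b by (intro powr_mono2') auto
          moreover have "indicator {-1..1} (z \<bullet> i) = (1::real)"
            using le True by (auto simp: indicator_def)
          ultimately show ?thesis using False by (simp add: h_def ennreal_leI)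
        qed (simp add: h_def)
      qed
      finally show ?thesis using True by simp
    qed auto
  qed
  also have "\<dots> = (\<Prod>i\<in>(Basis :: 'a set). (\<integral>\<^sup>+t. h t \<partial>lborel))"
    by (rule nn_integral_lborel_prod) auto
  also have "\<dots> < \<infinity>" using h_fin by (simp add: power_less_top_ennreal)
  finally show ?thesis .
qed

text \<open>
  The integral inside \<open>energy\<close>, with the exponents \<open>\<alpha> = s / \<theta> - d\<close> and \<open>p = 2 / \<theta>\<close> as free
  parameters.
\<close>

definition riesz_energy :: "real \<Rightarrow> real \<Rightarrow> (real ^ 'n) measure \<Rightarrow> ennreal" where
  "riesz_energy \<alpha> p \<mu> = (\<integral>\<^sup>+z. ennreal (norm (fourier_transform \<mu> z) powr p * norm z powr \<alpha>) \<partial>lborel)"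

text \<open>
  Outside the unit ball the two weights are comparable. Inside, the transform is at most its value
  at the origin, and the homogeneous weight is integrable because \<open>\<alpha> > - d\<close>.
\<close>

lemma riesz_energy_le:
  fixes \<delta> \<alpha> p :: real
  assumes \<delta>: "0 < \<delta>" "\<delta> < 1/2" and p: "1 < p" and \<alpha>: "- real CARD('n) < \<alpha>"
  obtains C :: real where "0 \<le> C"
    "\<And>\<mu> :: (real ^ 'n) measure. cube_measure \<delta> \<mu> \<Longrightarrow>
      riesz_energy \<alpha> p \<mu> \<le> ennreal C * (ennreal (norm (fourier_transform \<mu> 0) powr p) + bracket_energy \<alpha> p \<mu>)"
proof -
  define J where "J = (\<integral>\<^sup>+z. ennreal (norm z powr \<alpha> * indicator (ball 0 1) z) \<partial>(lborel :: (real ^ 'n) measure))"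
  have [measurable]: "(ball 0 1 :: (real ^ 'n) set) \<in> sets borel" by simp
  have "J < \<infinity>" unfolding J_def using \<alpha> by (intro nn_integral_norm_powr_ball_finite) simp
  then obtain j where j: "0 \<le> j" "J = ennreal j" by (cases J) auto
  define c where "c = 2 powr \<bar>\<alpha>\<bar>"
  have c: "0 \<le> c" by (simp add: c_def)
  show thesis
  proof
    show "0 \<le> j + c" using j c by simp
    fix \<mu> :: "(real ^ 'n) measure" assume \<mu>: "cube_measure \<delta> \<mu>"
    note [measurable] = measurable_fourier_transform[OF \<mu> \<delta>]
    have br_meas [measurable]: "bracket \<in> borel_measurable (borel :: (real ^ 'n) measure)"
      unfolding bracket_def[abs_def] by measurable
    let ?f = "fourier_transform \<mu>"
    let ?m = "norm (?f 0) powr p"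
    have "riesz_energy \<alpha> p \<mu> \<le> (\<integral>\<^sup>+z. ennreal ?m * ennreal (norm z powr \<alpha> * indicator (ball 0 1) z) +
        ennreal c * ennreal (bracket z powr \<alpha> * norm (?f z) powr p) \<partial>lborel)"
      unfolding riesz_energy_def
    proof (rule nn_integral_mono)
      fix z :: "real ^ 'n"
      have "norm (?f z) powr p * norm z powr \<alpha> \<le> ?m * (norm z powr \<alpha> * indicator (ball 0 1) z) + c * (bracket z powr \<alpha> * norm (?f z) powr p)"
      proof (cases "z \<in> ball 0 1")
        case True
        have "norm (?f z) powr p * norm z powr \<alpha> \<le> ?m * norm z powr \<alpha>"
          using p by (intro mult_right_mono powr_mono2 norm_fourier_transform_le[OF \<mu> \<delta>]) auto
        also have "\<dots> \<le> ?m * norm z powr \<alpha> + c * (bracket z powr \<alpha> * norm (?f z) powr p)" using c by simp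
        finally show ?thesis using True by simp
      next
        case False
        have "norm z powr \<alpha> \<le> c * bracket z powr \<alpha>"
          using bracket_norm_powr_comparable(1)[of 1 z \<alpha>] False by (simp add: c_def)
        then have "norm (?f z) powr p * norm z powr \<alpha> \<le> norm (?f z) powr p * (c * bracket z powr \<alpha>)"
          by (intro mult_left_mono) auto
        then show ?thesis using False by (simp add: mult_ac)
      qed
      then show "ennreal (norm (?f z) powr p * norm z powr \<alpha>) \<le>
         ennreal ?m * ennreal (norm z powr \<alpha> * indicator (ball 0 1) z) + ennreal c * ennreal (bracket z powr \<alpha> * norm (?f z) powr p)"
        using c by (simp add: ennreal_mult[symmetric] ennreal_plus[symmetric] ennreal_leI del: ennreal_plus)
    qed
    also have "\<dots> = (\<integral>\<^sup>+z. ennreal ?m * ennreal (norm z powr \<alpha> * indicator (ball 0 1) z) \<partial>(lborel :: (real ^ 'n) measure)) +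
        (\<integral>\<^sup>+z. ennreal c * ennreal (bracket z powr \<alpha> * norm (?f z) powr p) \<partial>lborel)"
      by (rule nn_integral_add) measurable
    also have "(\<integral>\<^sup>+z. ennreal ?m * ennreal (norm z powr \<alpha> * indicator (ball 0 1) z) \<partial>(lborel :: (real ^ 'n) measure)) = ennreal ?m * J"
      unfolding J_def by (rule nn_integral_cmult) measurable
    also have "(\<integral>\<^sup>+z. ennreal c * ennreal (bracket z powr \<alpha> * norm (?f z) powr p) \<partial>lborel) = ennreal c * bracket_energy \<alpha> p \<mu>"
      unfolding bracket_energy_def by (rule nn_integral_cmult) measurable
    also have "ennreal ?m * J + ennreal c * bracket_energy \<alpha> p \<mu> \<le> ennreal (j + c) * ennreal ?m + ennreal (j + c) * bracket_energy \<alpha> p \<mu>"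
      unfolding j(2) mult.commute[of "ennreal ?m"] using j(1) c
      by (intro add_mono mult_right_mono ennreal_leI) auto
    finally show "riesz_energy \<alpha> p \<mu> \<le> ennreal (j + c) * (ennreal ?m + bracket_energy \<alpha> p \<mu>)"
      by (simp add: distrib_left)
  qed
qed

text \<open>
  Near the origin the homogeneous weight may be much smaller than the inhomogeneous one, but the
  transform there is comparable to its value at \<open>0\<close>; so the part of either integral over a small
  ball is comparable to that value to the power \<open>p\<close>.
\<close>

lemma bracket_energy_le:
  fixes \<delta> \<alpha> p :: real
  assumes \<delta>: "0 < \<delta>" "\<delta> < 1/2" and p: "1 < p" and \<alpha>: "- real CARD('n) < \<alpha>"
  obtains C :: real where "0 \<le> C"
    "\<And>\<mu> :: (real ^ 'n) measure. cube_measure \<delta> \<mu> \<Longrightarrow> bracket_energy \<alpha> p \<mu> \<le> ennreal C * riesz_energy \<alpha> p \<mu>"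
proof -
  \<comment> \<open>On this ball the Lipschitz bound gives half of the value at the origin.\<close>
  define r where "r = 1 / (4 * pi * real CARD('n))"
  have r: "0 < r" "r \<le> 1"
  proof -
    show "0 < r" by (simp add: r_def)
    have "1 \<le> real CARD('n)" by (simp add: Suc_leI)
    then have "1 * 1 \<le> (4 * pi) * real CARD('n)" using pi_gt3 by (intro mult_mono) auto
    then show "r \<le> 1" by (simp add: r_def divide_le_eq_1)
  qed
  let ?B = "ball 0 r :: (real ^ 'n) set"
  have [measurable]: "?B \<in> sets borel" by simp
  define J where "J = (\<integral>\<^sup>+z. ennreal (norm z powr \<alpha> * indicator ?B z) \<partial>(lborel :: (real ^ 'n) measure))"
  have "J \<le> (\<integral>\<^sup>+z. ennreal (norm z powr \<alpha> * indicator (ball 0 1) z) \<partial>(lborel :: (real ^ 'n) measure))"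
    unfolding J_def using r(2) by (intro nn_integral_mono ennreal_leI mult_left_mono) (auto simp: indicator_def)
  also have "\<dots> < \<infinity>" using \<alpha> by (intro nn_integral_norm_powr_ball_finite) simp
  finally have "J < \<infinity>" .
  then obtain j where j: "0 \<le> j" "J = ennreal j" by (cases J) auto
  have "j \<noteq> 0"
  proof
    assume "j = 0"
    then have "J = 0" using j by simp
    then have "AE z in (lborel :: (real ^ 'n) measure). ennreal (norm z powr \<alpha> * indicator ?B z) = 0"
      unfolding J_def by (subst (asm) nn_integral_0_iff_AE) measurable
    then have "AE z in (lborel :: (real ^ 'n) measure). z \<notin> ?B"
      using AE_lborel_singleton[of "0 :: real ^ 'n"]
    proof eventually_elim
      case (elim z)
      then have "norm z powr \<alpha> > 0" by simp
      with elim show ?case by (cases "z \<in> ?B") auto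
    qed
    then have "?B \<in> null_sets lborel" by (subst AE_iff_null_sets) auto
    then have "emeasure lborel ?B = 0" by auto
    then show False using content_ball_pos[OF r(1), of "0 :: real ^ 'n"] by (simp add: measure_def)
  qed
  with j have j0: "0 < j" by simp
  define c where "c = (1 + 1 / r) powr \<bar>\<alpha>\<bar>"
  define v where "v = 2 powr \<bar>\<alpha>\<bar> * measure lborel ?B"
  have c: "0 \<le> c" and v: "0 \<le> v" by (auto simp: c_def v_def)
  show thesis
  proof
    show "0 \<le> c + v * (2 powr p / j)" using c v j0 by simp
    fix \<mu> :: "(real ^ 'n) measure" assume \<mu>: "cube_measure \<delta> \<mu>"
    note [measurable] = measurable_fourier_transform[OF \<mu> \<delta>]
    let ?f = "fourier_transform \<mu>"
    let ?m = "norm (?f 0) powr p"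
    have half: "?m \<le> 2 powr p * norm (?f z) powr p" if z: "z \<in> ?B" for z
    proof -
      have "norm (?f 0) - norm (?f z) \<le> norm (?f z - ?f 0)" by (metis norm_minus_commute norm_triangle_ineq2)
      also have "\<dots> \<le> 2 * pi * real CARD('n) * norm (z - 0) * norm (?f 0)"
        by (rule fourier_transform_lipschitz[OF \<mu> \<delta>])
      also have "\<dots> \<le> 2 * pi * real CARD('n) * r * norm (?f 0)"
        using z by (intro mult_right_mono mult_left_mono) auto
      also have "2 * pi * real CARD('n) * r = 1 / 2" by (simp add: r_def)
      finally have "norm (?f 0) \<le> 2 * norm (?f z)" by simp
      then have "?m \<le> (2 * norm (?f z)) powr p" using p by (intro powr_mono2) auto
      then show ?thesis by (simp add: powr_mult)
    qed
    have "ennreal ?m * J = (\<integral>\<^sup>+z. ennreal ?m * ennreal (norm z powr \<alpha> * indicator ?B z) \<partial>lborel)"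
      unfolding J_def by (rule nn_integral_cmult[symmetric]) simp
    also have "\<dots> \<le> (\<integral>\<^sup>+z. ennreal (2 powr p) * ennreal (norm (?f z) powr p * norm z powr \<alpha>) \<partial>lborel)"
    proof (rule nn_integral_mono)
      fix z :: "real ^ 'n"
      have "?m * (norm z powr \<alpha> * indicator ?B z) \<le> 2 powr p * (norm (?f z) powr p * norm z powr \<alpha>)"
        using mult_right_mono[OF half[of z], of "norm z powr \<alpha>"] by (auto simp: indicator_def mult.assoc)
      then show "ennreal ?m * ennreal (norm z powr \<alpha> * indicator ?B z) \<le> ennreal (2 powr p) * ennreal (norm (?f z) powr p * norm z powr \<alpha>)"
        by (simp add: ennreal_mult[symmetric] ennreal_leI)
    qed
    also have "\<dots> = ennreal (2 powr p) * riesz_energy \<alpha> p \<mu>"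
      unfolding riesz_energy_def by (rule nn_integral_cmult) measurable
    finally have "ennreal (1 / j) * (ennreal ?m * ennreal j) \<le> ennreal (1 / j) * (ennreal (2 powr p) * riesz_energy \<alpha> p \<mu>)"
      unfolding j(2) by (intro mult_left_mono) auto
    moreover have "ennreal (1 / j) * (ennreal ?m * ennreal j) = ennreal ?m"
      using j0 by (simp add: ennreal_mult[symmetric])
    moreover have "ennreal (1 / j) * (ennreal (2 powr p) * riesz_energy \<alpha> p \<mu>) = ennreal (2 powr p / j) * riesz_energy \<alpha> p \<mu>"
      using j0 by (simp add: ennreal_mult[symmetric] mult.assoc[symmetric])
    ultimately have m_le: "ennreal ?m \<le> ennreal (2 powr p / j) * riesz_energy \<alpha> p \<mu>" by simp
    have "bracket_energy \<alpha> p \<mu> \<le> (\<integral>\<^sup>+z. ennreal c * ennreal (norm (?f z) powr p * norm z powr \<alpha>) +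
        ennreal (2 powr \<bar>\<alpha>\<bar> * ?m) * indicator ?B z \<partial>lborel)"
      unfolding bracket_energy_def
    proof (rule nn_integral_mono)
      fix z :: "real ^ 'n"
      show "ennreal (bracket z powr \<alpha> * norm (?f z) powr p) \<le> ennreal c * ennreal (norm (?f z) powr p * norm z powr \<alpha>) +
        ennreal (2 powr \<bar>\<alpha>\<bar> * ?m) * indicator ?B z"
      proof (cases "z \<in> ?B")
        case True
        have "bracket z powr \<alpha> \<le> bracket z powr \<bar>\<alpha>\<bar>" by (intro powr_mono bracket_ge_1) auto
        also have "\<dots> \<le> 2 powr \<bar>\<alpha>\<bar>" using True r by (intro powr_mono2) (auto simp: bracket_def)
        finally have "bracket z powr \<alpha> * norm (?f z) powr p \<le> 2 powr \<bar>\<alpha>\<bar> * ?m"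
          using p by (intro mult_mono powr_mono2 norm_fourier_transform_le[OF \<mu> \<delta>]) auto
        then have "ennreal (bracket z powr \<alpha> * norm (?f z) powr p) \<le> ennreal (2 powr \<bar>\<alpha>\<bar> * ?m)" by (rule ennreal_leI)
        also have "\<dots> \<le> ennreal c * ennreal (norm (?f z) powr p * norm z powr \<alpha>) + ennreal (2 powr \<bar>\<alpha>\<bar> * ?m)"
          by (rule add_increasing) auto
        finally show ?thesis using True by simp
      next
        case False
        have "bracket z powr \<alpha> \<le> c * norm z powr \<alpha>"
          unfolding c_def using False by (intro bracket_norm_powr_comparable(2) r) auto
        then have "bracket z powr \<alpha> * norm (?f z) powr p \<le> (c * norm z powr \<alpha>) * norm (?f z) powr p"
          by (intro mult_right_mono) auto
        then show ?thesis using False c by (simp add: ennreal_mult[symmetric] ennreal_leI mult_ac)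
      qed
    qed
    also have "\<dots> = (\<integral>\<^sup>+z. ennreal c * ennreal (norm (?f z) powr p * norm z powr \<alpha>) \<partial>lborel) +
        (\<integral>\<^sup>+z. ennreal (2 powr \<bar>\<alpha>\<bar> * ?m) * indicator ?B z \<partial>lborel)"
      by (rule nn_integral_add) measurable
    also have "(\<integral>\<^sup>+z. ennreal c * ennreal (norm (?f z) powr p * norm z powr \<alpha>) \<partial>lborel) = ennreal c * riesz_energy \<alpha> p \<mu>"
      unfolding riesz_energy_def by (rule nn_integral_cmult) measurable
    also have "(\<integral>\<^sup>+z. ennreal (2 powr \<bar>\<alpha>\<bar> * ?m) * indicator ?B z \<partial>lborel) = ennreal (2 powr \<bar>\<alpha>\<bar> * ?m) * emeasure lborel ?B"
      by (rule nn_integral_cmult_indicator) simp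
    also have "emeasure lborel ?B = ennreal (measure lborel ?B)"
      using emeasure_lborel_ball_finite[of "0 :: real ^ 'n" r] by (intro emeasure_eq_ennreal_measure) auto
    also have "ennreal (2 powr \<bar>\<alpha>\<bar> * ?m) * ennreal (measure lborel ?B) = ennreal v * ennreal ?m"
      by (simp add: v_def ennreal_mult[symmetric] mult_ac)
    also have "ennreal c * riesz_energy \<alpha> p \<mu> + ennreal v * ennreal ?m \<le>
        ennreal c * riesz_energy \<alpha> p \<mu> + ennreal v * (ennreal (2 powr p / j) * riesz_energy \<alpha> p \<mu>)"
      by (intro add_left_mono mult_left_mono m_le) auto
    also have "\<dots> = ennreal (c + v * (2 powr p / j)) * riesz_energy \<alpha> p \<mu>"
    proof -
      have q: "0 \<le> 2 powr p / j" using j0 by simp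
      have "ennreal (c + v * (2 powr p / j)) = ennreal c + ennreal v * ennreal (2 powr p / j)"
        unfolding ennreal_plus[OF c mult_nonneg_nonneg[OF v q]] ennreal_mult[OF v q] ..
      then show ?thesis by (simp only: distrib_right mult.assoc)
    qed
    finally show "bracket_energy \<alpha> p \<mu> \<le> ennreal (c + v * (2 powr p / j)) * riesz_energy \<alpha> p \<mu>" .
  qed
qed

section \<open>The integer lattice\<close>

lemma bij_betw_lattice_pt:
  "bij_betw lattice_pt (- {\<lambda>_. 0}) (int_lattice - {0 :: real ^ 'n})"
proof (rule bij_betw_byWitness[where f' = "\<lambda>z i. \<lfloor>z $ i\<rfloor>"])
  show "lattice_pt ` (- {\<lambda>_. 0}) \<subseteq> int_lattice - {0 :: real ^ 'n}"
    by (auto simp: int_lattice_def vec_eq_iff fun_eq_iff)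
  have "\<exists>i. \<lfloor>z $ i\<rfloor> \<noteq> 0" if "\<forall>i. z $ i \<in> \<int>" "z \<noteq> 0" for z :: "real ^ 'n"
  proof -
    from that(2) obtain i where "z $ i \<noteq> 0" by (auto simp: vec_eq_iff)
    moreover have "z $ i = of_int \<lfloor>z $ i\<rfloor>" using that(1) by (metis Ints_cases floor_of_int)
    ultimately have "\<lfloor>z $ i\<rfloor> \<noteq> 0" by auto
    then show ?thesis ..
  qed
  then show "(\<lambda>z i. \<lfloor>z $ i\<rfloor>) ` (int_lattice - {0 :: real ^ 'n}) \<subseteq> - {\<lambda>_. 0}"
    by (auto simp: int_lattice_def fun_eq_iff) blast
qed (auto simp: int_lattice_def vec_eq_iff fun_eq_iff elim: Ints_cases)

lemma norm_lattice_pt_ge_1: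
  assumes "j \<noteq> (\<lambda>_. 0)"
  shows "1 \<le> norm (lattice_pt j :: real ^ 'n)"
proof -
  from assms obtain i where "j i \<noteq> 0" by (auto simp: fun_eq_iff)
  then have "1 \<le> \<bar>real_of_int (j i)\<bar>" by linarith
  also have "\<dots> = \<bar>(lattice_pt j :: real ^ 'n) $ i\<bar>" by simp
  also have "\<dots> \<le> norm (lattice_pt j :: real ^ 'n)" by (rule component_le_norm_cart)
  finally show ?thesis .
qed

lemma lattice_sum_eq_nn_integral:
  fixes \<mu> :: "(real ^ 'n) measure"
  shows "lattice_sum s \<theta> \<mu> = (\<integral>\<^sup>+j. ennreal (norm (fourier_transform \<mu> (lattice_pt j)) powr (2 / \<theta>) *
     norm (lattice_pt j :: real ^ 'n) powr (s / \<theta> - real CARD('n))) * indicator (- {\<lambda>_. 0}) j \<partial>count_space UNIV)"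
  unfolding lattice_sum_def infsum_reindex_bij_betw[OF bij_betw_lattice_pt, symmetric]
    nn_integral_count_space_eq_infsum[symmetric]
  by (rule nn_integral_count_space_indicator) (simp add: NO_MATCH_def)

text \<open>
  Nonzero lattice points have norm at least one, where the two weights agree up to \<open>2 powr \<bar>\<alpha>\<bar>\<close>,
  and the term of \<open>lattice_block\<close> at the origin has weight one: it is the separate summand in \<open>D\<close>.
\<close>

lemma lattice_sum_lattice_block:
  fixes \<mu> :: "(real ^ 'n) measure" and s \<theta> :: real
  defines "\<alpha> \<equiv> s / \<theta> - real CARD('n)" and "p \<equiv> 2 / \<theta>"
  defines "D \<equiv> ennreal (norm (fourier_transform \<mu> 0) powr p) + lattice_sum s \<theta> \<mu>"
  shows "D \<le> ennreal (2 powr \<bar>\<alpha>\<bar>) * lattice_block \<alpha> p \<mu> 0"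
    and "lattice_block \<alpha> p \<mu> 0 \<le> ennreal (2 powr \<bar>\<alpha>\<bar>) * D"
proof -
  let ?f = "fourier_transform \<mu>" and ?O = "(\<lambda>_. 0) :: 'n \<Rightarrow> int"
  have O: "lattice_pt ?O = (0 :: real ^ 'n)" by (simp add: vec_eq_iff)
  have c: "1 \<le> 2 powr \<bar>\<alpha>\<bar>" by (rule ge_one_powr_ge_zero) auto
  define T where "T j = norm (?f (lattice_pt j)) powr p * (if j = ?O then 1 else norm (lattice_pt j :: real ^ 'n) powr \<alpha>)" for j
  have "ennreal (norm (?f 0) powr p) = (\<integral>\<^sup>+j. ennreal (norm (?f 0) powr p) * indicator {?O} j \<partial>count_space UNIV)"
    by (subst nn_integral_cmult_indicator) auto
  then have "D = (\<integral>\<^sup>+j. ennreal (norm (?f 0) powr p) * indicator {?O} j +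
      ennreal (norm (?f (lattice_pt j)) powr p * norm (lattice_pt j :: real ^ 'n) powr \<alpha>) * indicator (- {?O}) j \<partial>count_space UNIV)"
    unfolding D_def lattice_sum_eq_nn_integral \<alpha>_def[symmetric] p_def[symmetric]
    by (subst nn_integral_add) auto
  also have "\<dots> = (\<integral>\<^sup>+j. ennreal (T j) \<partial>count_space UNIV)"
    by (intro nn_integral_cong) (auto simp: T_def O indicator_def)
  finally have D: "D = (\<integral>\<^sup>+j. ennreal (T j) \<partial>count_space UNIV)" .
  define b where "b j = bracket (lattice_pt j :: real ^ 'n) powr \<alpha> * norm (?f (lattice_pt j)) powr p" for j
  have block: "lattice_block \<alpha> p \<mu> 0 = (\<integral>\<^sup>+j. ennreal (b j) \<partial>count_space UNIV)"
    by (simp add: lattice_block_def b_def)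
  have T_b: "T j \<le> 2 powr \<bar>\<alpha>\<bar> * b j" and b_T: "b j \<le> 2 powr \<bar>\<alpha>\<bar> * T j" for j
  proof -
    have "T j \<le> 2 powr \<bar>\<alpha>\<bar> * b j \<and> b j \<le> 2 powr \<bar>\<alpha>\<bar> * T j"
    proof (cases "j = ?O")
      case True
      have "bracket (0 :: real ^ 'n) = 1" by (simp add: bracket_def)
      then show ?thesis using True c mult_right_mono[OF c, of "norm (?f 0) powr p"]
        by (simp add: T_def b_def O)
    next
      case False
      note cmp = bracket_norm_powr_comparable[of 1 "lattice_pt j :: real ^ 'n" \<alpha>, OF _ norm_lattice_pt_ge_1[OF False], simplified]
      show ?thesis
        using mult_left_mono[OF cmp(1), of "norm (?f (lattice_pt j)) powr p"]
          mult_left_mono[OF cmp(2), of "norm (?f (lattice_pt j)) powr p"] False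
        by (simp add: T_def b_def mult_ac)
    qed
    then show "T j \<le> 2 powr \<bar>\<alpha>\<bar> * b j" "b j \<le> 2 powr \<bar>\<alpha>\<bar> * T j" by auto
  qed
  have mono: "(\<integral>\<^sup>+j. ennreal (x j) \<partial>count_space UNIV) \<le> ennreal (2 powr \<bar>\<alpha>\<bar>) * (\<integral>\<^sup>+j. ennreal (y j) \<partial>count_space UNIV)"
    if "\<And>j. x j \<le> 2 powr \<bar>\<alpha>\<bar> * y j" "\<And>j. 0 \<le> y j" for x y :: "('n \<Rightarrow> int) \<Rightarrow> real"
  proof -
    have "(\<integral>\<^sup>+j. ennreal (x j) \<partial>count_space UNIV) \<le> (\<integral>\<^sup>+j. ennreal (2 powr \<bar>\<alpha>\<bar>) * ennreal (y j) \<partial>count_space UNIV)"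
      using that by (intro nn_integral_mono) (simp add: ennreal_mult[symmetric] ennreal_leI)
    also have "\<dots> = ennreal (2 powr \<bar>\<alpha>\<bar>) * (\<integral>\<^sup>+j. ennreal (y j) \<partial>count_space UNIV)"
      by (rule nn_integral_cmult) simp
    finally show ?thesis .
  qed
  show "D \<le> ennreal (2 powr \<bar>\<alpha>\<bar>) * lattice_block \<alpha> p \<mu> 0"
    unfolding D block by (rule mono[OF T_b]) (simp add: b_def)
  show "lattice_block \<alpha> p \<mu> 0 \<le> ennreal (2 powr \<bar>\<alpha>\<bar>) * D"
    unfolding D block by (rule mono[OF b_T]) (simp add: T_def)
qed

lemma riesz_energy_lattice_sum:
  fixes \<delta> s \<theta> :: real
  assumes \<delta>: "0 < \<delta>" "\<delta> < 1/2" and \<theta>: "0 < \<theta>" "\<theta> \<le> 1" and s: "0 < s"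
  obtains C :: real where "0 < C"
    "\<And>\<mu> :: (real ^ 'n) measure. cube_measure \<delta> \<mu> \<Longrightarrow>
       riesz_energy (s / \<theta> - real CARD('n)) (2 / \<theta>) \<mu> \<le>
         ennreal C * (ennreal (norm (fourier_transform \<mu> 0) powr (2 / \<theta>)) + lattice_sum s \<theta> \<mu>)"
    "\<And>\<mu> :: (real ^ 'n) measure. cube_measure \<delta> \<mu> \<Longrightarrow>
       ennreal (norm (fourier_transform \<mu> 0) powr (2 / \<theta>)) + lattice_sum s \<theta> \<mu> \<le>
         ennreal C * riesz_energy (s / \<theta> - real CARD('n)) (2 / \<theta>) \<mu>"
proof -
  define \<alpha> where "\<alpha> = s / \<theta> - real CARD('n)"
  define p where "p = 2 / \<theta>"
  have p: "1 < p" using \<theta> by (simp add: p_def field_simps)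
  have \<alpha>: "- real CARD('n) < \<alpha>" using \<theta> s by (simp add: \<alpha>_def)
  define D where "D \<mu> = ennreal (norm (fourier_transform \<mu> 0) powr p) + lattice_sum s \<theta> \<mu>" for \<mu> :: "(real ^ 'n) measure"
  define c where "c = 2 powr \<bar>\<alpha>\<bar>"
  have c: "0 \<le> c" by (simp add: c_def)
  obtain C1 where C1: "0 \<le> C1" "\<And>\<mu> :: (real ^ 'n) measure. cube_measure \<delta> \<mu> \<Longrightarrow>
      riesz_energy \<alpha> p \<mu> \<le> ennreal C1 * (ennreal (norm (fourier_transform \<mu> 0) powr p) + bracket_energy \<alpha> p \<mu>)"
    by (rule riesz_energy_le[OF \<delta> p \<alpha>]) (rule that)
  obtain C2 where C2: "0 \<le> C2"
    "\<And>\<mu> :: (real ^ 'n) measure. cube_measure \<delta> \<mu> \<Longrightarrow> bracket_energy \<alpha> p \<mu> \<le> ennreal C2 * lattice_block \<alpha> p \<mu> 0"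
    "\<And>\<mu> :: (real ^ 'n) measure. cube_measure \<delta> \<mu> \<Longrightarrow> lattice_block \<alpha> p \<mu> 0 \<le> ennreal C2 * bracket_energy \<alpha> p \<mu>"
    by (rule bracket_energy_lattice_block[OF \<delta> p, of \<alpha>]) (rule that)
  obtain C3 where C3: "0 \<le> C3"
    "\<And>\<mu> :: (real ^ 'n) measure. cube_measure \<delta> \<mu> \<Longrightarrow> bracket_energy \<alpha> p \<mu> \<le> ennreal C3 * riesz_energy \<alpha> p \<mu>"
    by (rule bracket_energy_le[OF \<delta> p \<alpha>]) (rule that)
  have block: "D \<mu> \<le> ennreal c * lattice_block \<alpha> p \<mu> 0" "lattice_block \<alpha> p \<mu> 0 \<le> ennreal c * D \<mu>" for \<mu>
    using lattice_sum_lattice_block[where \<mu> = \<mu> and s = s and \<theta> = \<theta>] by (simp_all add: D_def c_def p_def \<alpha>_def)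
  define C where "C = 1 + C1 * (1 + C2 * c) + c * (C2 * C3)"
  have le: "C1 * (1 + C2 * c) \<le> C" "c * (C2 * C3) \<le> C" and C: "0 < C"
    using C1(1) C2(1) C3(1) c by (auto simp: C_def intro!: add_pos_nonneg add_nonneg_nonneg mult_nonneg_nonneg)
  have 1: "riesz_energy \<alpha> p \<mu> \<le> ennreal C * D \<mu>" if \<mu>: "cube_measure \<delta> \<mu>" for \<mu> :: "(real ^ 'n) measure"
  proof -
    have "riesz_energy \<alpha> p \<mu> \<le> ennreal C1 * (D \<mu> + ennreal C2 * (ennreal c * D \<mu>))"
      by (rule order_trans[OF C1(2)[OF \<mu>]], intro mult_left_mono add_mono order_trans[OF C2(2)[OF \<mu>]] block)
         (simp_all add: D_def)
    also have "\<dots> = ennreal (C1 * (1 + C2 * c)) * D \<mu>"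
      using C1(1) C2(1) c by (simp add: ennreal_mult ennreal_plus distrib_right distrib_left mult.assoc)
    also have "\<dots> \<le> ennreal C * D \<mu>" by (intro mult_right_mono ennreal_leI le) simp
    finally show ?thesis .
  qed
  have 2: "D \<mu> \<le> ennreal C * riesz_energy \<alpha> p \<mu>" if \<mu>: "cube_measure \<delta> \<mu>" for \<mu> :: "(real ^ 'n) measure"
  proof -
    have "D \<mu> \<le> ennreal c * (ennreal C2 * (ennreal C3 * riesz_energy \<alpha> p \<mu>))"
      by (rule order_trans[OF block(1)], intro mult_left_mono order_trans[OF C2(3)[OF \<mu>]] C3(2) \<mu>) simp_all
    also have "\<dots> = ennreal (c * (C2 * C3)) * riesz_energy \<alpha> p \<mu>"
      using C3(1) C2(1) c by (simp add: ennreal_mult mult.assoc)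
    also have "\<dots> \<le> ennreal C * riesz_energy \<alpha> p \<mu>" by (intro mult_right_mono ennreal_leI le) simp
    finally show ?thesis .
  qed
  show thesis
    by (rule that[OF C]) (use 1 2 in \<open>simp_all add: D_def \<alpha>_def p_def\<close>)
qed

section \<open>Energies and Fourier spectrum\<close>

text \<open>
  Transfers the two-sided estimate from the integral and the sum to their powers.
\<close>

lemma ennreal_powr_mono_mult:
  assumes xy: "x \<le> ennreal C * y" and C: "0 < C" and a: "0 < a"
  shows "ennreal_powr x a \<le> ennreal (C powr a) * ennreal_powr y a"
proof (cases "y = \<infinity>")
  case True
  then show ?thesis using C by (simp add: ennreal_powr_def ennreal_mult_top)
next
  case False
  then obtain v where v: "0 \<le> v" "y = ennreal v" by (cases y) auto
  have "x \<le> ennreal (C * v)" using xy v C by (simp add: ennreal_mult)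
  moreover from this have "x \<noteq> \<infinity>" by (auto simp: top_unique)
  ultimately obtain u where u: "0 \<le> u" "x = ennreal u" "u \<le> C * v"
    using v C by (cases x) (auto simp: ennreal_le_iff)
  have "u powr a \<le> (C * v) powr a" using u a by (intro powr_mono2) auto
  then show ?thesis using u v C
    by (simp add: ennreal_powr_def powr_mult ennreal_mult[symmetric] ennreal_leI)
qed

lemma ennreal_powr_less_top: "ennreal_powr x a < \<infinity> \<longleftrightarrow> x < \<infinity>"
  by (auto simp: ennreal_powr_def less_top)

text \<open>
  For negative \<open>s\<close> the bound by the value at the origin suffices, since the weights alone are
  summable: from \<open>(\<Prod>i. bracket (z $ i)) \<le> bracket z ^ d\<close> the exponent \<open>\<alpha> < - d\<close> is distributed over the
  coordinates as \<open>\<alpha> / d < - 1\<close>. This is why the supremum over all real \<open>s\<close> is never negative.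
\<close>

lemma lattice_sum_finite_negative:
  fixes \<mu> :: "(real ^ 'n) measure"
  assumes \<mu>: "cube_measure \<delta> \<mu>" and \<delta>: "0 < \<delta>" "\<delta> < 1/2" and \<theta>: "0 < \<theta>" and s: "s < 0"
  shows "lattice_sum s \<theta> \<mu> < \<infinity>"
proof -
  let ?f = "fourier_transform \<mu>" and ?d = "real CARD('n)"
  define \<alpha> where "\<alpha> = s / \<theta> - ?d"
  define q where "q = \<alpha> / ?d"
  have "s / \<theta> < 0" using \<theta> s by (simp add: divide_neg_pos)
  then have \<alpha>: "\<alpha> < - ?d" by (simp add: \<alpha>_def)
  have d: "0 < ?d" by simp
  have q: "q < -1" unfolding q_def using \<alpha> d by (simp only: pos_divide_less_eq)
  define g where "g j = (\<Prod>i\<in>UNIV. bracket (real_of_int (j i)) powr q)" for j :: "'n \<Rightarrow> int"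
  have g: "0 \<le> g j" for j by (auto simp: g_def intro: prod_nonneg)
  have g_summable: "g summable_on UNIV" unfolding g_def by (rule summable_on_prod_bracket[OF q])
  define M where "M = norm (?f 0) powr (2 / \<theta>) * 2 powr \<bar>\<alpha>\<bar>"
  have bound: "norm (?f (lattice_pt j)) powr (2 / \<theta>) * norm (lattice_pt j :: real ^ 'n) powr \<alpha> \<le> M * g j"
    if j: "j \<noteq> (\<lambda>_. 0)" for j
  proof -
    let ?z = "lattice_pt j :: real ^ 'n"
    have "(\<Prod>i\<in>UNIV. bracket (?z $ i)) \<le> (\<Prod>i\<in>(UNIV :: 'n set). bracket ?z)"
      using component_le_norm_cart[of ?z] by (intro prod_mono) (auto simp: bracket_def)
    also have "\<dots> = bracket ?z powr ?d" by (simp add: powr_realpow)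
    finally have "(bracket ?z powr ?d) powr q \<le> (\<Prod>i\<in>UNIV. bracket (?z $ i)) powr q"
      using q by (intro powr_mono2') (auto intro!: prod_pos)
    then have "bracket ?z powr \<alpha> \<le> g j"
      using d by (simp add: powr_powr q_def g_def prod_powr_distrib)
    then have "2 powr \<bar>\<alpha>\<bar> * bracket ?z powr \<alpha> \<le> 2 powr \<bar>\<alpha>\<bar> * g j" by (intro mult_left_mono) auto
    moreover have "norm ?z powr \<alpha> \<le> 2 powr \<bar>\<alpha>\<bar> * bracket ?z powr \<alpha>"
      using bracket_norm_powr_comparable(1)[of 1 ?z \<alpha>] norm_lattice_pt_ge_1[OF j] by simp
    ultimately have "norm ?z powr \<alpha> \<le> 2 powr \<bar>\<alpha>\<bar> * g j" by linarith
    then have "norm (?f ?z) powr (2 / \<theta>) * norm ?z powr \<alpha> \<le> norm (?f 0) powr (2 / \<theta>) * (2 powr \<bar>\<alpha>\<bar> * g j)"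
      using \<theta> g by (intro mult_mono powr_mono2 norm_fourier_transform_le[OF \<mu> \<delta>]) auto
    then show ?thesis by (simp add: M_def mult.assoc)
  qed
  have "lattice_sum s \<theta> \<mu> \<le> (\<integral>\<^sup>+j. ennreal (M * g j) \<partial>count_space UNIV)"
    unfolding lattice_sum_eq_nn_integral \<alpha>_def[symmetric]
  proof (rule nn_integral_mono)
    fix j :: "'n \<Rightarrow> int"
    show "ennreal (norm (?f (lattice_pt j)) powr (2 / \<theta>) * norm (lattice_pt j :: real ^ 'n) powr \<alpha>) * indicator (- {\<lambda>_. 0}) j
        \<le> ennreal (M * g j)"
      using bound[of j] by (cases "j = (\<lambda>_. 0)") (auto simp: ennreal_leI)
  qed
  also have "\<dots> = ennreal (infsum (\<lambda>j. M * g j) UNIV)"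
    by (rule nn_integral_count_space_summable) (use g g_summable in \<open>auto simp: M_def intro!: summable_on_cmult_right\<close>)
  also have "\<dots> < \<infinity>" by simp
  finally show ?thesis .
qed

theorem theorem3p1:
  fixes \<delta> :: real
  assumes "0 < \<delta>" and "\<delta> < 1/2"
  shows "(\<forall>\<theta> s :: real. 0 < \<theta> \<longrightarrow> \<theta> \<le> 1 \<longrightarrow> 0 < s \<longrightarrow>
           (\<exists>c > 0 :: real. \<forall>\<mu> :: (real ^ 'n) measure.
              finite_measure \<mu> \<longrightarrow> sets \<mu> = sets borel \<longrightarrow>
              measure_support \<mu> \<subseteq> {x. \<forall>i. \<delta> \<le> x $ i \<and> x $ i \<le> 1 - \<delta>} \<longrightarrow>
              (let D = ennreal_powr
                   (ennreal (norm (fourier_transform \<mu> 0) powr (2 / \<theta>)) + lattice_sum s \<theta> \<mu>) \<theta>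
               in energy s \<theta> \<mu> \<le> ennreal c * D \<and> D \<le> ennreal c * energy s \<theta> \<mu>))) \<and>
         (\<forall>\<mu> :: (real ^ 'n) measure.
            finite_measure \<mu> \<longrightarrow> sets \<mu> = sets borel \<longrightarrow>
            measure_support \<mu> \<subseteq> {x. \<forall>i. \<delta> \<le> x $ i \<and> x $ i \<le> 1 - \<delta>} \<longrightarrow>
            (\<forall>\<theta> :: real. 0 < \<theta> \<longrightarrow> \<theta> \<le> 1 \<longrightarrow>
               enn2ereal (fourier_spectrum \<theta> \<mu>) =
                 Sup {ereal s | s :: real. lattice_sum s \<theta> \<mu> < \<infinity>}))"
    (is "?comparison \<and> ?spectrum")
proof
  have main: "\<exists>c > 0. \<forall>\<mu> :: (real ^ 'n) measure. cube_measure \<delta> \<mu> \<longrightarrow>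
       energy s \<theta> \<mu> \<le> ennreal c * ennreal_powr (ennreal (norm (fourier_transform \<mu> 0) powr (2 / \<theta>)) + lattice_sum s \<theta> \<mu>) \<theta> \<and>
       ennreal_powr (ennreal (norm (fourier_transform \<mu> 0) powr (2 / \<theta>)) + lattice_sum s \<theta> \<mu>) \<theta> \<le> ennreal c * energy s \<theta> \<mu>"
    if \<theta>: "0 < \<theta>" "\<theta> \<le> 1" and s: "0 < s" for \<theta> s :: real
  proof -
    obtain C where C: "0 < C"
      "\<And>\<mu> :: (real ^ 'n) measure. cube_measure \<delta> \<mu> \<Longrightarrow>
         riesz_energy (s / \<theta> - real CARD('n)) (2 / \<theta>) \<mu> \<le>
           ennreal C * (ennreal (norm (fourier_transform \<mu> 0) powr (2 / \<theta>)) + lattice_sum s \<theta> \<mu>)"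
      "\<And>\<mu> :: (real ^ 'n) measure. cube_measure \<delta> \<mu> \<Longrightarrow>
         ennreal (norm (fourier_transform \<mu> 0) powr (2 / \<theta>)) + lattice_sum s \<theta> \<mu> \<le>
           ennreal C * riesz_energy (s / \<theta> - real CARD('n)) (2 / \<theta>) \<mu>"
      by (rule riesz_energy_lattice_sum[OF assms \<theta> s]) (rule that)
    have energy: "energy s \<theta> \<mu> = ennreal_powr (riesz_energy (s / \<theta> - real CARD('n)) (2 / \<theta>) \<mu>) \<theta>"
      for \<mu> :: "(real ^ 'n) measure"
      by (simp add: energy_def riesz_energy_def)
    show ?thesis
      unfolding energy
    proof (intro exI[of _ "C powr \<theta>"] conjI allI impI)
      show "0 < C powr \<theta>" using C(1) by simp
    qed (intro ennreal_powr_mono_mult C \<theta>; assumption)+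
  qed
  have adm: "cube_measure \<delta> \<mu>" if "finite_measure \<mu>" "sets \<mu> = sets borel"
    "measure_support \<mu> \<subseteq> {x. \<forall>i. \<delta> \<le> x $ i \<and> x $ i \<le> 1 - \<delta>}" for \<mu> :: "(real ^ 'n) measure"
    using that by (rule cube_measureI)
  show ?comparison
  proof (intro allI impI)
    fix \<theta> s :: real assume "0 < \<theta>" "\<theta> \<le> 1" "0 < s"
    then show "\<exists>c > 0 :: real. \<forall>\<mu> :: (real ^ 'n) measure.
              finite_measure \<mu> \<longrightarrow> sets \<mu> = sets borel \<longrightarrow>
              measure_support \<mu> \<subseteq> {x. \<forall>i. \<delta> \<le> x $ i \<and> x $ i \<le> 1 - \<delta>} \<longrightarrow>
              (let D = ennreal_powr
                   (ennreal (norm (fourier_transform \<mu> 0) powr (2 / \<theta>)) + lattice_sum s \<theta> \<mu>) \<theta>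
               in energy s \<theta> \<mu> \<le> ennreal c * D \<and> D \<le> ennreal c * energy s \<theta> \<mu>)"
      using main[of \<theta> s] adm unfolding Let_def by blast
  qed
  show ?spectrum
  proof (intro allI impI)
    fix \<mu> :: "(real ^ 'n) measure" and \<theta> :: real
    assume "finite_measure \<mu>" "sets \<mu> = sets borel"
      "measure_support \<mu> \<subseteq> {x. \<forall>i. \<delta> \<le> x $ i \<and> x $ i \<le> 1 - \<delta>}" and \<theta>: "0 < \<theta>" "\<theta> \<le> 1"
    then have \<mu>: "cube_measure \<delta> \<mu>" by (intro adm)
    have iff: "energy s \<theta> \<mu> < \<infinity> \<longleftrightarrow> lattice_sum s \<theta> \<mu> < \<infinity>" if s: "0 < s" for s
    proof -
      define D where "D = ennreal (norm (fourier_transform \<mu> 0) powr (2 / \<theta>)) + lattice_sum s \<theta> \<mu>"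
      obtain c where c: "energy s \<theta> \<mu> \<le> ennreal c * ennreal_powr D \<theta>"
        "ennreal_powr D \<theta> \<le> ennreal c * energy s \<theta> \<mu>"
        using main[OF \<theta> s] \<mu> unfolding D_def by blast
      have "energy s \<theta> \<mu> < \<infinity> \<longleftrightarrow> ennreal_powr D \<theta> < \<infinity>"
        using order_le_less_trans[OF c(1), of \<infinity>] order_le_less_trans[OF c(2), of \<infinity>]
        by (auto simp: ennreal_mult_less_top)
      also have "\<dots> \<longleftrightarrow> D < \<infinity>" by (rule ennreal_powr_less_top)
      also have "\<dots> \<longleftrightarrow> lattice_sum s \<theta> \<mu> < \<infinity>" by (simp add: D_def less_top)
      finally show ?thesis .
    qed
    let ?S = "Sup {ereal s | s :: real. lattice_sum s \<theta> \<mu> < \<infinity>}"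
    \<comment> \<open>A negative supremum would leave room for a negative exponent above it, at which the lattice sum is nevertheless finite.\<close>
    have S_nonneg: "0 \<le> ?S"
    proof (rule ccontr)
      assume "\<not> 0 \<le> ?S"
      then have "?S < 0" by (simp only: not_le)
      then obtain s where s: "?S < ereal s" "ereal s < 0" using ereal_dense2[of ?S 0] by blast
      then have "lattice_sum s \<theta> \<mu> < \<infinity>"
        by (intro lattice_sum_finite_negative[OF \<mu> assms \<theta>(1)]) simp
      then have "ereal s \<le> ?S" by (intro Sup_upper) auto
      with s(1) show False by simp
    qed
    show "enn2ereal (fourier_spectrum \<theta> \<mu>) = ?S"
    proof (rule antisym)
      have "fourier_spectrum \<theta> \<mu> \<le> e2ennreal ?S"
        unfolding fourier_spectrum_def
      proof (rule Sup_least, clarify)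
        fix s :: real assume s: "0 \<le> s" "energy s \<theta> \<mu> < \<infinity>"
        show "ennreal s \<le> e2ennreal ?S"
        proof (cases "s = 0")
          case False
          then have "ereal s \<le> ?S" using s iff[of s] by (intro Sup_upper) auto
          then have "e2ennreal (ereal s) \<le> e2ennreal ?S" by (rule e2ennreal_mono)
          moreover have "e2ennreal (ereal s) = ennreal s"
            using e2ennreal_enn2ereal[of "ennreal s"] unfolding enn2ereal_ennreal[OF s(1)] .
          ultimately show ?thesis by (simp only:)
        qed simp
      qed
      then have "enn2ereal (fourier_spectrum \<theta> \<mu>) \<le> enn2ereal (e2ennreal ?S)" by (simp add: less_eq_ennreal.rep_eq)
      then show "enn2ereal (fourier_spectrum \<theta> \<mu>) \<le> ?S" unfolding enn2ereal_e2ennreal[OF S_nonneg] .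
      show "?S \<le> enn2ereal (fourier_spectrum \<theta> \<mu>)"
      proof (rule Sup_least, clarify)
        fix s :: real assume fin: "lattice_sum s \<theta> \<mu> < \<infinity>"
        show "ereal s \<le> enn2ereal (fourier_spectrum \<theta> \<mu>)"
        proof (cases "0 < s")
          case True
          then have "ennreal s \<le> fourier_spectrum \<theta> \<mu>"
            unfolding fourier_spectrum_def using fin iff[OF True] by (intro Sup_upper) auto
          then have "enn2ereal (ennreal s) \<le> enn2ereal (fourier_spectrum \<theta> \<mu>)" by (simp add: less_eq_ennreal.rep_eq)
          then show ?thesis using True by (simp add: enn2ereal_ennreal)
        next
          case False
          then have "ereal s \<le> 0" by simp
          also have "0 \<le> enn2ereal (fourier_spectrum \<theta> \<mu>)" by (rule enn2ereal_nonneg)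
          finally show ?thesis .
        qed
      qed
    qed
  qed
qed

end
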